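(* Let $m\in\mathbb{N}$ be fixed with $m\ge 2$, and let $F$ be a non-degenerate distribution function with $F(0-)=0$. (i) $C_{\rm b}(m,p;F)$ satisfies (SD) for every $p\in(0,1)$ if and only if $F\in\mathcal{H}$. (ii) $C_{\rm b}(m,p;F)$ satisfies (SD$^*$) for every $p\in(0,1)$ if and only if $F\in\mathcal{H}^\ast$.
   Context: $\mathbb{N}$ is the set of positive integers, $\mathbb{R}_+=[0,\infty)$, $\mathbb{R}_{++}=(0,\infty)$. For a distribution function $F$, $\overline F=1-F$; non-degenerate means not the distribution function of a constant. Classes: for a non-degenerate distribution function $F$ with $F(0-)=0$, $F\in\mathcal{H}$ if $x\mapsto\overline F(1/x)$ is concave on $\mathbb{R}_{++}$; $F\in\mathcal{H}^\ast$ if $x\mapsto\overline F(1/x)$ is subadditive on $\mathbb{R}_{++}$, i.e. $\overline F\left(\frac1{x+y}\right)\le\overline F\left(\frac1x\right)+\overline F\left(\frac1y\right)$ for all $x,y>0$. Compound binomial distribution: $C_{\rm b}(m,p;F)$ is the distribution of $\sum_{i=1}^N Z_i$, where $Z_1,Z_2,\ldots$ are i.i.d. with distribution function $F$, $N$ is binomial with parameters $m$ and $p$, and $N$ is independent of the $Z_i$ (the empty sum is $0$). Usual stochastic order: $U\le_{\rm st}W$ means $\mathbb{P}(U>x)\le\mathbb{P}(W>x)$ for all $x\in\mathbb{R}$. Majorization: for $\mathbf{a},\mathbf{b}\in\mathbb{R}^n$ with increasing rearrangements $a_{(1)}\le\cdots\le a_{(n)}$, $b_{(1)}\le\cdots\le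 b_{(n)}$, $\mathbf{a}\preceq_{\rm m}\mathbf{b}$ means $\sum_{i=1}^n a_{(i)}=\sum_{i=1}^n b_{(i)}$ and $\sum_{i=1}^j a_{(i)}\ge\sum_{i=1}^j b_{(i)}$ for $j=1,\ldots,n-1$. A distribution $D$ satisfies (SD) if, for every $n\ge 2$ and i.i.d. $X_1,\ldots,X_n$ with distribution $D$, $\sum_{i=1}^n\eta_iX_i\le_{\rm st}\sum_{i=1}^n\theta_iX_i$ for all $\boldsymbol\theta,\boldsymbol\eta\in\mathbb{R}_+^n$ with $\boldsymbol\theta\preceq_{\rm m}\boldsymbol\eta$. A distribution $D$ satisfies (SD$^*$) if, for every $n\ge 2$ and i.i.d. $X_1,\ldots,X_n$ with distribution $D$, $\left(\sum_{i=1}^n\theta_i\right)X_1\le_{\rm st}\sum_{i=1}^n\theta_iX_i$ for all $\boldsymbol\theta\in\mathbb{R}_+^n$. *)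

theory Defs
  imports "HOL-Probability.Probability"
begin

definition distribution_function :: "(real \<Rightarrow> real) \<Rightarrow> bool" where
  "distribution_function F \<longleftrightarrow>
     mono F \<and> (\<forall>x. continuous (at_right x) F) \<and> (F \<longlongrightarrow> 0) at_bot \<and> (F \<longlongrightarrow> 1) at_top"

definition non_degenerate :: "(real \<Rightarrow> real) \<Rightarrow> bool" where
  "non_degenerate F \<longleftrightarrow> \<not> (\<exists>c. \<forall>x. F x = (if c \<le> x then 1 else 0))"

text \<open>The condition \<open>F(0-) = 0\<close> is rendered as \<open>(F \<longlongrightarrow> 0) (at_left 0)\<close>; an atom at \<open>0\<close> is allowed.\<close>

definition admissible :: "(real \<Rightarrow> real) \<Rightarrow> bool" where
  "admissible F \<longleftrightarrow>
     distribution_function F \<and> non_degenerate F \<and> (F \<longlongrightarrow> 0) (at_left 0)"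

definition survival :: "(real \<Rightarrow> real) \<Rightarrow> real \<Rightarrow> real" where
  "survival F x = 1 - F x"

definition class_H :: "(real \<Rightarrow> real) set" where
  "class_H = {F. admissible F \<and> concave_on {0<..} (\<lambda>x. survival F (1 / x))}"

definition class_H_star :: "(real \<Rightarrow> real) set" where
  "class_H_star = {F. admissible F \<and>
     (\<forall>x>0. \<forall>y>0. survival F (1 / (x + y)) \<le> survival F (1 / x) + survival F (1 / y))}"

text \<open>
  The law of \<open>Z\<^sub>1 + \<dots> + Z\<^sub>N\<close>, realised on the canonical product space: the first factor carries
  \<open>N\<close>, the second one the i.i.d. sequence \<open>Z\<^sub>1, Z\<^sub>2, \<dots>\<close> with distribution function \<open>F\<close>.
\<close>

definition compound_binomial :: "nat \<Rightarrow> real \<Rightarrow> (real \<Rightarrow> real) \<Rightarrow> real measure" where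
  "compound_binomial m p F =
     distr (measure_pmf (binomial_pmf m p) \<Otimes>\<^sub>M (\<Pi>\<^sub>M i\<in>{1::nat..}. interval_measure F)) borel
       (\<lambda>(N, Z). \<Sum>i=1..N. Z i)"

definition st_le :: "'a measure \<Rightarrow> ('a \<Rightarrow> real) \<Rightarrow> ('a \<Rightarrow> real) \<Rightarrow> bool" where
  "st_le M U W \<longleftrightarrow> (\<forall>x. \<P>(\<omega> in M. U \<omega> > x) \<le> \<P>(\<omega> in M. W \<omega> > x))"

text \<open>
  Vectors in \<open>\<real>\<^sup>n\<close> are functions \<open>nat \<Rightarrow> real\<close> of which only the values on \<open>{1..n}\<close> matter;
  \<open>incr_rearr n a i\<close> is \<open>a_(i)\<close> for \<open>1 \<le> i \<le> n\<close> (list positions start at \<open>0\<close>).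
\<close>

definition incr_rearr :: "nat \<Rightarrow> (nat \<Rightarrow> real) \<Rightarrow> nat \<Rightarrow> real" where
  "incr_rearr n a i = sort (map a [1..<Suc n]) ! (i - 1)"

definition majorized :: "nat \<Rightarrow> (nat \<Rightarrow> real) \<Rightarrow> (nat \<Rightarrow> real) \<Rightarrow> bool" where
  "majorized n a b \<longleftrightarrow>
     (\<Sum>i=1..n. incr_rearr n a i) = (\<Sum>i=1..n. incr_rearr n b i) \<and>
     (\<forall>j\<in>{1..n-1}. (\<Sum>i=1..j. incr_rearr n a i) \<ge> (\<Sum>i=1..j. incr_rearr n b i))"

text \<open>
  Both sides of the stochastic inequalities depend only on the joint law of \<open>X\<^sub>1, \<dots>, X\<^sub>n\<close>, so the
  i.i.d. sample is taken to be the coordinates of the \<open>n\<close>-fold product measure of \<open>D\<close>.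
\<close>

definition SD :: "real measure \<Rightarrow> bool" where
  "SD D \<longleftrightarrow> (\<forall>n\<ge>2. \<forall>\<theta> \<eta> :: nat \<Rightarrow> real.
     (\<forall>i\<in>{1..n}. \<theta> i \<ge> 0) \<and> (\<forall>i\<in>{1..n}. \<eta> i \<ge> 0) \<and> majorized n \<theta> \<eta> \<longrightarrow>
     st_le (\<Pi>\<^sub>M i\<in>{1..n}. D) (\<lambda>X. \<Sum>i=1..n. \<eta> i * X i) (\<lambda>X. \<Sum>i=1..n. \<theta> i * X i))"

definition SD_star :: "real measure \<Rightarrow> bool" where
  "SD_star D \<longleftrightarrow> (\<forall>n\<ge>2. \<forall>\<theta> :: nat \<Rightarrow> real.
     (\<forall>i\<in>{1..n}. \<theta> i \<ge> 0) \<longrightarrow>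
     st_le (\<Pi>\<^sub>M i\<in>{1..n}. D) (\<lambda>X. (\<Sum>i=1..n. \<theta> i) * X 1) (\<lambda>X. \<Sum>i=1..n. \<theta> i * X i))"

end

theory Submission
  imports Defs
begin

text \<open>
  The sum \<open>Z\<^sub>1 + \<dots> + Z\<^sub>N\<close> with binomial \<open>N\<close> has the same law as \<open>B\<^sub>1 Z\<^sub>1 + \<dots> + B\<^sub>m Z\<^sub>m\<close> with
  independent Bernoulli variables \<open>B\<^sub>k\<close>. Write \<open>\<kappa>\<^sub>p\<close> for the law of the thinned variable \<open>B Z\<close>. Its
  tail on \<open>[0, \<infinity>)\<close> is \<open>p\<close> times the tail of \<open>F\<close>, so \<open>\<kappa>\<^sub>p\<close> inherits concavity or subadditivity of
  \<open>x \<mapsto> survival F (1 / x)\<close>. All identities between laws of weighted sums are read off from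
  characteristic functions (lemmas \<open>compound_binomial_eq\<close>, \<open>weighted_sum_law_of_sum_law\<close> and
  \<open>weighted_sample_law\<close>); in particular a weighted sum of compound binomial variables is a sum of
  \<open>m\<close> independent copies of the same weighted sum of thinned variables. Since convolution preserves
  the stochastic order, an inequality for \<open>\<kappa>\<^sub>p\<close> yields the one for the compound binomial law.

  Necessity. As \<open>p\<close> tends to \<open>0\<close>, a weighted sum exceeds \<open>t\<close> essentially only if a single
  summand does, so its tail divided by \<open>p\<close> converges to a sum of tails of \<open>F\<close> at \<open>t / c\<close>
  (lemma \<open>weighted_sum_thinned_derivative\<close>). Dividing the stochastic inequalities for two
  weights by \<open>p\<close> therefore gives subadditivity from the comparison with a single variable and midpoint
  concavity from the comparison with equal weights; monotonicity upgrades the latter to concavity.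

  Sufficiency, subadditive case. For two weights the event \<open>a X + b Y > t\<close> contains three
  disjoint events whose probabilities already add up to enough (lemma
  \<open>two_weights_subadditive\<close>); the general case follows by adding one weight at a time.

  Sufficiency, concave case. Majorization decomposes into transfers between two weights
  (lemma \<open>majorization_induct\<close>), so it is enough to show that the tail of \<open>a X + b Y\<close> grows when
  \<open>a\<close> and \<open>b\<close> move towards each other. A law whose tail is concave in \<open>1 / s\<close> is a limit of finite
  mixtures of the laws of \<open>w / U\<close> with \<open>U\<close> uniform (lemma \<open>pareto_mixture_approximation\<close>).
  For fixed scales \<open>w\<close> and \<open>v\<close> the inequality can fail, but the sum of the tails of
  \<open>a w / U + b v / V\<close> and \<open>b w / U + a v / V\<close> is monotone: both tails equal \<open>\<phi> s P\<close> with the common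
  product \<open>P = a b w v / t\<^sup>2\<close> and with \<open>s = (a w + b v) / t\<close>, respectively
  \<open>s = (b w + a v) / t\<close>, where \<open>\<phi>\<close> is increasing in \<open>P\<close> and concave in \<open>s\<close> (lemma
  \<open>pareto_pair_transfer\<close>). This symmetrized functional is linear in the law of each of the two
  variables separately, so the inequality passes to general laws one variable at a time.
\<close>

section \<open>Laws of weighted sums and the stochastic order\<close>

definition st_dominated :: "real measure \<Rightarrow> real measure \<Rightarrow> bool" where
  "st_dominated M N \<longleftrightarrow> (\<forall>t. measure M {t<..} \<le> measure N {t<..})"

text \<open>
  The law of \<open>c\<^sub>1 X\<^sub>1 + \<dots> + c\<^sub>n X\<^sub>n\<close> for independent \<open>X\<^sub>i\<close> with law \<open>D\<close>. Lists of weights make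
  concatenation correspond to adding independent sums and permit induction on the number of summands.
\<close>

primrec weighted_sum_law :: "real measure \<Rightarrow> real list \<Rightarrow> real measure" where
  "weighted_sum_law D [] = return borel 0"
| "weighted_sum_law D (c # cs) = (distr D borel (\<lambda>x. c * x) \<star> weighted_sum_law D cs)"

lemma st_dominated_refl [simp]: "st_dominated M M"
  by (simp add: st_dominated_def)

lemma st_dominated_trans [trans]:
  "st_dominated M N \<Longrightarrow> st_dominated N L \<Longrightarrow> st_dominated M L"
  unfolding st_dominated_def by (meson order_trans)

lemma real_distribution_convolution:
  assumes "real_distribution M" "real_distribution N"
  shows "real_distribution (M \<star> N)"
proof -
  interpret M: real_distribution M by fact
  interpret N: real_distribution N by fact
  interpret P: pair_prob_space M N ..
  show ?thesis
    unfolding convolution_def case_prod_beta by (intro P.real_distribution_distr) simp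
qed

lemma real_distribution_scale:
  assumes "real_distribution D"
  shows "real_distribution (distr D borel (\<lambda>x. c * x))"
proof -
  interpret real_distribution D by fact
  show ?thesis by (intro real_distribution_distr) simp
qed

lemma real_distribution_return: "real_distribution (return borel (x :: real))"
  by (simp add: prob_space_return real_distribution_axioms_def real_distribution_def)

lemma real_distribution_weighted_sum_law:
  "real_distribution D \<Longrightarrow> real_distribution (weighted_sum_law D cs)"
  by (induction cs)
    (auto intro!: real_distribution_convolution real_distribution_scale real_distribution_return)

text \<open>
  Boundedness supplies the integrability that Fubini needs; only indicators and complex
  exponentials are ever integrated.
\<close>

lemma integral_convolution:
  fixes f :: "real \<Rightarrow> 'b :: {banach, second_countable_topology}"
  assumes "real_distribution M" "real_distribution N"
    and [measurable]: "f \<in> borel_measurable borel" and bdd: "\<And>x. norm (f x) \<le> B"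
  shows "(\<integral>x. f x \<partial>(M \<star> N)) = (\<integral>y. (\<integral>x. f (x + y) \<partial>M) \<partial>N)"
proof -
  interpret M: real_distribution M by fact
  interpret N: real_distribution N by fact
  interpret P: pair_prob_space M N ..
  have int: "integrable (M \<Otimes>\<^sub>M N) (\<lambda>(x, y). f (x + y))"
    by (rule P.integrable_const_bound[where B = B]) (auto simp: bdd case_prod_beta)
  have "(\<integral>x. f x \<partial>(M \<star> N)) = (\<integral>z. (\<lambda>(x, y). f (x + y)) z \<partial>(M \<Otimes>\<^sub>M N))"
    unfolding convolution_def by (subst integral_distr) (auto simp: case_prod_beta'[abs_def] split_beta)
  also have "\<dots> = (\<integral>y. (\<integral>x. f (x + y) \<partial>M) \<partial>N)"
    by (rule P.integral_snd[symmetric, where f = "\<lambda>x y. f (x + y)"]) (use int in simp)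
  finally show ?thesis .
qed

lemma tail_convolution:
  assumes "real_distribution M" "real_distribution N"
  shows "measure (M \<star> N) {t<..} = (\<integral>y. measure M {t - y<..} \<partial>N)"
proof -
  interpret M: real_distribution M by fact
  have "measure (M \<star> N) {t<..} = (\<integral>x. indicator {t<..} x \<partial>(M \<star> N))"
    by (simp add: sets_eq_imp_space_eq[OF sets_convolution])
  also have "\<dots> = (\<integral>y. (\<integral>x. indicator {t<..} (x + y) \<partial>M) \<partial>N)"
    by (rule integral_convolution[where B = 1, OF assms]) (auto simp: indicator_def)
  also have "(\<lambda>y. \<integral>x. indicator {t<..} (x + y) \<partial>M) = (\<lambda>y. measure M {t - y<..})"
  proof
    fix y
    have "(\<lambda>x. indicator {t<..} (x + y) :: real) = indicator {t - y<..}"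
      by (auto simp: indicator_def fun_eq_iff)
    then show "(\<integral>x. indicator {t<..} (x + y) \<partial>M) = measure M {t - y<..}"
      by simp
  qed
  finally show ?thesis .
qed

lemma char_convolution:
  assumes "real_distribution M" "real_distribution N"
  shows "char (M \<star> N) t = char M t * char N t"
proof -
  have "char (M \<star> N) t = (\<integral>y. (\<integral>x. iexp (t * (x + y)) \<partial>M) \<partial>N)"
    unfolding char_def
    by (rule integral_convolution[where B = 1, OF assms]) simp_all
  also have "\<dots> = (\<integral>y. (\<integral>x. iexp (t * x) \<partial>M) * iexp (t * y) \<partial>N)"
    by (simp add: distrib_left exp_add)
  finally show ?thesis by (simp add: char_def)
qed

lemma char_scale:
  assumes "real_distribution D"
  shows "char (distr D borel (\<lambda>x. c * x)) t = char D (c * t)"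
proof -
  interpret real_distribution D by fact
  show ?thesis by (simp add: char_def integral_distr mult_ac)
qed

lemma char_weighted_sum_law:
  assumes "real_distribution D"
  shows "char (weighted_sum_law D cs) t = (\<Prod>c\<leftarrow>cs. char D (c * t))"
proof (induction cs)
  case Nil
  show ?case by (simp add: char_def integral_return)
next
  case (Cons c cs)
  then show ?case using assms
    by (simp add: char_convolution char_scale real_distribution_scale
        real_distribution_weighted_sum_law)
qed

text \<open>
  By Levy's uniqueness theorem, equality of laws reduces to an identity between finite products.
\<close>

lemma weighted_sum_law_cong_char:
  assumes "real_distribution D" and "\<And>t. (\<Prod>c\<leftarrow>cs. char D (c * t)) = (\<Prod>c\<leftarrow>ds. char D (c * t))"
  shows "weighted_sum_law D cs = weighted_sum_law D ds"
  using assms by (intro Levy_uniqueness real_distribution_weighted_sum_law)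
    (auto simp: char_weighted_sum_law fun_eq_iff)

lemma weighted_sum_law_mset_cong:
  assumes "real_distribution D" "mset cs = mset ds"
  shows "weighted_sum_law D cs = weighted_sum_law D ds"
proof (rule weighted_sum_law_cong_char[OF assms(1)])
  fix t
  have "mset (map (\<lambda>c. char D (c * t)) cs) = mset (map (\<lambda>c. char D (c * t)) ds)"
    using assms(2) by simp
  then show "(\<Prod>c\<leftarrow>cs. char D (c * t)) = (\<Prod>c\<leftarrow>ds. char D (c * t))"
    by (metis prod_mset_prod_list)
qed

lemma weighted_sum_law_append:
  assumes "real_distribution D"
  shows "weighted_sum_law D (cs @ ds) = (weighted_sum_law D cs \<star> weighted_sum_law D ds)"
  using assms
  by (intro Levy_uniqueness real_distribution_weighted_sum_law real_distribution_convolution)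
    (auto simp: char_weighted_sum_law char_convolution real_distribution_weighted_sum_law fun_eq_iff)

lemma weighted_sum_law_singleton:
  assumes "real_distribution D"
  shows "weighted_sum_law D [c] = distr D borel (\<lambda>x. c * x)"
  using assms
  by (intro Levy_uniqueness real_distribution_weighted_sum_law real_distribution_scale)
    (auto simp: char_weighted_sum_law char_scale fun_eq_iff simp del: weighted_sum_law.simps)

lemma weighted_sum_law_zeros:
  assumes "real_distribution D" "\<forall>c\<in>set ds. c = 0"
  shows "weighted_sum_law D (cs @ ds) = weighted_sum_law D cs"
proof (rule weighted_sum_law_cong_char[OF assms(1)])
  interpret real_distribution D by fact
  fix t
  have "(\<Prod>c\<leftarrow>ds. char D (c * t)) = 1"
    using assms(2) by (induction ds) (auto simp: char_zero)
  then show "(\<Prod>c\<leftarrow>cs @ ds. char D (c * t)) = (\<Prod>c\<leftarrow>cs. char D (c * t))" by simp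
qed

text \<open>
  Regrouping: if every \<open>X\<^sub>i\<close> is itself a sum of \<open>m\<close> independent variables with law \<open>D\<close>, the
  weighted sum splits into \<open>m\<close> independent copies of the weighted sum over \<open>D\<close>, because
  \<open>\<Prod>c. \<phi> (c t) ^ m = (\<Prod>c. \<phi> (c t)) ^ m\<close>.
\<close>

lemma weighted_sum_law_of_sum_law:
  assumes "real_distribution D"
  shows "weighted_sum_law (weighted_sum_law D (replicate m 1)) cs
       = weighted_sum_law D (concat (replicate m cs))"
proof (rule Levy_uniqueness)
  have *: "(\<Prod>c\<leftarrow>concat (replicate m cs). f c) = (\<Prod>c\<leftarrow>cs. f c ^ m)" for f :: "real \<Rightarrow> complex"
  proof -
    have "(\<Prod>c\<leftarrow>concat (replicate m cs). f c) = (\<Prod>c\<leftarrow>cs. f c) ^ m"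
      by (induction m) auto
    also have "\<dots> = (\<Prod>c\<leftarrow>cs. f c ^ m)"
      by (induction cs) (auto simp: power_mult_distrib)
    finally show ?thesis .
  qed
  show "char (weighted_sum_law (weighted_sum_law D (replicate m 1)) cs)
      = char (weighted_sum_law D (concat (replicate m cs)))"
    using assms
    by (auto simp: fun_eq_iff char_weighted_sum_law real_distribution_weighted_sum_law *
        map_replicate_const prod_list_replicate)
qed (use assms in \<open>auto intro!: real_distribution_weighted_sum_law\<close>)

text \<open>
  The index set may be infinite, so that the lemma also covers the canonical sequence space on
  which the compound law is realised.
\<close>

lemma char_sum_coordinates:
  assumes "real_distribution D" "J \<subseteq> I"
  shows "char (distr (\<Pi>\<^sub>M i\<in>I. D) borel (\<lambda>X. \<Sum>i\<in>J. \<theta> i * X i)) t = (\<Prod>i\<in>J. char D (\<theta> i * t))"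
proof -
  interpret D: real_distribution D by fact
  interpret P: product_prob_space "\<lambda>_. D" I ..
  have "P.indep_vars (\<lambda>_. D) (\<lambda>i X. X i) I"
  proof (cases "I = {}")
    case True
    then show ?thesis
      unfolding P.indep_vars_def P.indep_sets_def by auto
  next
    case False
    have "distr (Pi\<^sub>M I (\<lambda>_. D)) (Pi\<^sub>M I (\<lambda>_. D)) (\<lambda>X. restrict X I)
        = distr (Pi\<^sub>M I (\<lambda>_. D)) (Pi\<^sub>M I (\<lambda>_. D)) (\<lambda>X. X)"
      by (intro distr_cong) (auto simp: space_PiM)
    moreover have "(\<Pi>\<^sub>M i\<in>I. distr (Pi\<^sub>M I (\<lambda>_. D)) D (\<lambda>X. X i)) = Pi\<^sub>M I (\<lambda>_. D)"
      by (intro PiM_cong refl distr_PiM_component) (auto intro: D.prob_space_axioms)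
    ultimately show ?thesis
      using False by (subst P.indep_vars_iff_distr_eq_PiM') (auto simp: restrict_def)
  qed
  then have "P.indep_vars (\<lambda>_. borel) (\<lambda>i X. \<theta> i * X i) I"
    by (rule P.indep_vars_compose2) simp
  then have "P.indep_vars (\<lambda>_. borel) (\<lambda>i X. \<theta> i * X i) J"
    by (rule P.indep_vars_subset) (rule assms(2))
  then have "char (distr (\<Pi>\<^sub>M i\<in>I. D) borel (\<lambda>X. \<Sum>i\<in>J. \<theta> i * X i)) t
      = (\<Prod>i\<in>J. char (distr (\<Pi>\<^sub>M i\<in>I. D) borel (\<lambda>X. \<theta> i * X i)) t)"
    by (rule P.char_distr_sum)
  also have "\<dots> = (\<Prod>i\<in>J. char D (\<theta> i * t))"
  proof (rule prod.cong[OF refl])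
    fix i assume "i \<in> J"
    then have i: "i \<in> I" using assms(2) by auto
    have "distr (\<Pi>\<^sub>M i\<in>I. D) borel (\<lambda>X. \<theta> i * X i)
        = distr (distr (\<Pi>\<^sub>M i\<in>I. D) borel (\<lambda>X. X i)) borel (\<lambda>x. \<theta> i * x)"
      using i by (subst distr_distr) (auto simp: o_def)
    also have "distr (\<Pi>\<^sub>M i\<in>I. D) borel (\<lambda>X. X i) = distr (\<Pi>\<^sub>M i\<in>I. D) D (\<lambda>X. X i)"
      by (intro distr_cong) auto
    also have "\<dots> = D"
      using i by (intro distr_PiM_component) (auto intro: D.prob_space_axioms)
    finally show "char (distr (\<Pi>\<^sub>M i\<in>I. D) borel (\<lambda>X. \<theta> i * X i)) t = char D (\<theta> i * t)"
      using char_scale[OF assms(1)] by simp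
  qed
  finally show ?thesis .
qed

lemma weighted_sample_law:
  assumes "real_distribution D"
  shows "distr (\<Pi>\<^sub>M i\<in>{1..n}. D) borel (\<lambda>X. \<Sum>i=1..n. \<theta> i * X i)
       = weighted_sum_law D (map \<theta> [1..<Suc n])"
proof (rule Levy_uniqueness)
  interpret D: real_distribution D by fact
  interpret P: product_prob_space "\<lambda>_::nat. D" "{1..n}" ..
  show "real_distribution (distr (\<Pi>\<^sub>M i\<in>{1..n}. D) borel (\<lambda>X. \<Sum>i=1..n. \<theta> i * X i))"
    by (intro P.real_distribution_distr) measurable
  have "(\<Prod>i=1..n. char D (\<theta> i * t)) = (\<Prod>c\<leftarrow>map \<theta> [1..<Suc n]. char D (c * t))" for t
    by (simp add: o_def prod.distinct_set_conv_list[symmetric] atLeastLessThanSuc_atLeastAtMost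
        del: upt_Suc)
  then show "char (distr (\<Pi>\<^sub>M i\<in>{1..n}. D) borel (\<lambda>X. \<Sum>i=1..n. \<theta> i * X i))
      = char (weighted_sum_law D (map \<theta> [1..<Suc n]))"
    by (simp add: fun_eq_iff char_weighted_sum_law char_sum_coordinates assms
        del: upt_Suc weighted_sum_law.simps)
qed (rule real_distribution_weighted_sum_law[OF assms])

lemma convolution_commute:
  "real_distribution M \<Longrightarrow> real_distribution N \<Longrightarrow> (M \<star> N) = (N \<star> M)"
  by (rule Levy_uniqueness)
    (auto simp: real_distribution_convolution char_convolution fun_eq_iff)

lemma tail_borel_measurable [measurable]:
  assumes "real_distribution M"
  shows "(\<lambda>x. measure M {x<..}) \<in> borel_measurable borel"
proof -
  interpret real_distribution M by fact
  have "(\<lambda>x. - measure M {x<..}) \<in> borel_measurable borel"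
    by (intro borel_measurable_mono monoI) (auto intro!: finite_measure_mono)
  then show ?thesis by simp
qed

lemma convolution_mono_left:
  assumes "real_distribution M" "real_distribution M'" "real_distribution N" "st_dominated M M'"
  shows "st_dominated (M \<star> N) (M' \<star> N)"
  unfolding st_dominated_def
proof
  fix t
  interpret M: real_distribution M by fact
  interpret M': real_distribution M' by fact
  interpret N: real_distribution N by fact
  note [measurable] = tail_borel_measurable[OF assms(1)] tail_borel_measurable[OF assms(2)]
  have "(\<integral>y. measure M {t - y<..} \<partial>N) \<le> (\<integral>y. measure M' {t - y<..} \<partial>N)"
    using assms(4)
    by (intro integral_mono N.integrable_const_bound[where B = 1]) (auto simp: st_dominated_def)
  then show "measure (M \<star> N) {t<..} \<le> measure (M' \<star> N) {t<..}"
    by (simp add: tail_convolution assms)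
qed

lemma convolution_mono:
  assumes "real_distribution M" "real_distribution M'" "real_distribution N" "real_distribution N'"
    and "st_dominated M M'" "st_dominated N N'"
  shows "st_dominated (M \<star> N) (M' \<star> N')"
proof -
  have "st_dominated (M \<star> N) (M' \<star> N)"
    by (rule convolution_mono_left) fact+
  also have "(M' \<star> N) = (N \<star> M')" by (rule convolution_commute) fact+
  also have "st_dominated (N \<star> M') (N' \<star> M')"
    by (rule convolution_mono_left) fact+
  also have "(N' \<star> M') = (M' \<star> N')" by (rule convolution_commute) fact+
  finally show ?thesis .
qed

text \<open>
  A stochastic inequality between two sums survives the addition of independent copies; this
  is how an inequality for the summands reaches the compound law.
\<close>

lemma weighted_sum_law_concat_mono:
  assumes "real_distribution D" "st_dominated (weighted_sum_law D cs) (weighted_sum_law D ds)"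
  shows "st_dominated (weighted_sum_law D (concat (replicate m cs)))
           (weighted_sum_law D (concat (replicate m ds)))"
  using assms
  by (induction m)
    (auto simp: weighted_sum_law_append intro!: convolution_mono real_distribution_weighted_sum_law)

section \<open>Majorization as a chain of transfers\<close>

lemma sorted_bracket:
  fixes x :: real
  assumes "sorted ys" "length ys \<ge> 2" "hd ys \<le> x" "x \<le> last ys"
  shows "\<exists>us a b vs. ys = us @ a # b # vs \<and> a \<le> x \<and> x \<le> b"
  using assms
proof (induction ys)
  case (Cons y ys)
  show ?case
  proof (cases "x \<le> hd ys")
    case True
    then show ?thesis using Cons.prems
      by (intro exI[of _ "[]"] exI[of _ y] exI[of _ "hd ys"] exI[of _ "tl ys"])
        (cases ys; simp)
  next
    case False
    then have "length ys \<ge> 2" using Cons.prems by (cases ys; cases "tl ys") auto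
    then have "\<exists>us a b vs. ys = us @ a # b # vs \<and> a \<le> x \<and> x \<le> b"
      using Cons False by (intro Cons.IH) (auto split: if_splits)
    then show ?thesis by (metis append_Cons)
  qed
qed simp

lemma sum_list_bounds:
  fixes c :: real
  shows "(\<And>x. x \<in> set xs \<Longrightarrow> c \<le> x) \<Longrightarrow> real (length xs) * c \<le> sum_list xs"
    and "(\<And>x. x \<in> set xs \<Longrightarrow> x \<le> c) \<Longrightarrow> sum_list xs \<le> real (length xs) * c"
  by (induction xs) (force simp: algebra_simps)+

text \<open>
  An induction principle for majorization of sorted lists. Let \<open>x\<close> be the smallest entry of the
  less spread list. It lies between two neighbours \<open>a\<close>, \<open>b\<close> of the more spread list; replacing them
  by \<open>x\<close> and \<open>a + b - x\<close> is a transfer that creates the entry \<open>x\<close> in both lists. Cancelling it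
  leaves a pair of shorter sorted lists that is again majorized.
\<close>

lemma majorization_induct:
  fixes R :: "real list \<Rightarrow> real list \<Rightarrow> bool"
  assumes refl: "\<And>xs. R xs xs"
    and trans: "\<And>xs ys zs. R xs ys \<Longrightarrow> R ys zs \<Longrightarrow> R xs zs"
    and perm: "\<And>us a vs. R (us @ a # vs) (a # us @ vs) \<and> R (a # us @ vs) (us @ a # vs)"
    and cons: "\<And>c xs ys. 0 \<le> c \<Longrightarrow> (\<And>x. x \<in> set xs \<union> set ys \<Longrightarrow> 0 \<le> x) \<Longrightarrow> R xs ys \<Longrightarrow> R (c # xs) (c # ys)"
    and transfer: "\<And>a b c d cs. 0 \<le> a \<Longrightarrow> a \<le> c \<Longrightarrow> c \<le> b \<Longrightarrow> a + b = c + d \<Longrightarrow>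
        (\<And>x. x \<in> set cs \<Longrightarrow> 0 \<le> x) \<Longrightarrow> R (a # b # cs) (c # d # cs)"
    and len: "length ys = length xs" and sorted: "sorted xs" "sorted ys"
    and nonneg: "\<And>x. x \<in> set xs \<union> set ys \<Longrightarrow> 0 \<le> x"
    and total: "sum_list xs = sum_list ys"
    and partial: "\<And>j. j \<le> length xs \<Longrightarrow> sum_list (take j ys) \<le> sum_list (take j xs)"
  shows "R ys xs"
  using len sorted nonneg total partial
proof (induction xs arbitrary: ys)
  case Nil
  then show ?case using refl[of "[]"] by simp
next
  case (Cons x xs)
  note ge_x = \<open>sorted (x # xs)\<close>[simplified]
  show ?case
  proof (cases "length ys = 1")
    case True
    then obtain y where "ys = [y]" by (auto simp: length_Suc_conv)
    with Cons.prems refl show ?thesis by simp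
  next
    case False
    then have len2: "length ys \<ge> 2" using Cons.prems(1) by (cases ys; cases "tl ys") auto
    have "hd ys \<le> x"
      using Cons.prems(6)[of 1] len2 by (cases ys) auto
    moreover have "x \<le> last ys"
    proof (rule ccontr)
      assume "\<not> x \<le> last ys"
      then have lt: "last ys < x" by simp
      have "y \<le> last ys" if "y \<in> set ys" for y
        using that \<open>sorted ys\<close> by (cases ys rule: rev_cases) (auto simp: sorted_append)
      then have "sum_list ys \<le> real (length ys) * last ys" by (rule sum_list_bounds)
      also have "\<dots> < real (length ys) * x"
        using lt len2 by (intro mult_strict_left_mono) auto
      also have "\<dots> \<le> sum_list (x # xs)"
        unfolding Cons.prems(1) using ge_x by (intro sum_list_bounds) auto
      finally show False using Cons.prems(5) by simp
    qed
    ultimately obtain us a b vs where ys: "ys = us @ a # b # vs" and ax: "a \<le> x" and xb: "x \<le> b"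
      using sorted_bracket[OF \<open>sorted ys\<close> len2] by blast
    define z where "z = a + b - x"
    define ws where "ws = us @ z # vs"
    have az: "a \<le> z" and zb: "z \<le> b" using ax xb by (auto simp: z_def)
    have nn: "0 \<le> a" "0 \<le> b" "0 \<le> x" "0 \<le> z"
      using Cons.prems(4) az by (auto simp: ys intro: order_trans)
    have nnl: "0 \<le> y" if "y \<in> set us \<union> set vs \<union> set xs" for y
      using that Cons.prems(4) by (auto simp: ys)
    have "R ws xs"
    proof (rule Cons.IH)
      show "length ws = length xs" using Cons.prems(1) by (simp add: ws_def ys)
      show "sorted xs" using ge_x by simp
      show "sorted ws" using \<open>sorted ys\<close> az zb
        by (auto simp: ws_def ys sorted_append intro: order_trans)
      show "0 \<le> y" if "y \<in> set xs \<union> set ws" for y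
        using that nnl nn by (auto simp: ws_def)
      show "sum_list xs = sum_list ws"
        using Cons.prems(5) by (simp add: ws_def ys z_def)
      show "sum_list (take j ws) \<le> sum_list (take j xs)" if j: "j \<le> length xs" for j
      \<comment> \<open>Up to the bracketed pair, entries are compared with \<open>x\<close>; beyond it, \<open>x\<close> cancels from the
        partial sums of the original lists.\<close>
      proof (cases "j \<le> length us")
        case True
        have "sum_list (take j ws) = sum_list (take j us)" using True by (simp add: ws_def)
        also have "\<dots> \<le> real j * x"
        proof -
          have "u \<le> x" if "u \<in> set (take j us)" for u
            using in_set_takeD[OF that] \<open>sorted ys\<close> ax by (auto simp: ys sorted_append)
          then show ?thesis using sum_list_bounds(2)[of "take j us" x] True by (simp add: min_absorb2)
        qed
        also have "\<dots> \<le> sum_list (take j xs)"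
          using sum_list_bounds(1)[of "take j xs" x] ge_x j by (auto dest: in_set_takeD simp: min_absorb2)
        finally show ?thesis .
      next
        case False
        define i where "i = j - Suc (length us)"
        have ji: "j = Suc (length us + i)" using False by (simp add: i_def)
        have "sum_list (take j ws) = sum_list (take (Suc j) ys) - x"
          by (simp add: ws_def ys z_def ji take_Cons')
        also have "\<dots> \<le> sum_list (take (Suc j) (x # xs)) - x"
          using Cons.prems(6)[of "Suc j"] j by simp
        also have "\<dots> = sum_list (take j xs)" by simp
        finally show ?thesis .
      qed
    qed
    have "R ys (a # us @ b # vs)" unfolding ys using perm by simp
    moreover have "R (a # us @ b # vs) (a # b # us @ vs)"
      using perm nn nnl by (intro cons) auto
    moreover have "R (a # b # us @ vs) (x # z # us @ vs)"
      using nn ax xb nnl by (intro transfer) (auto simp: z_def)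
    moreover have "R (x # z # us @ vs) (x # ws)"
      unfolding ws_def using perm nn nnl by (intro cons) auto
    moreover have "R (x # ws) (x # xs)"
      using \<open>R ws xs\<close> nn nnl by (intro cons) (auto simp: ws_def)
    ultimately show ?thesis by (rule trans[OF trans[OF trans[OF trans]]])
  qed
qed

section \<open>Two Pareto variables with tail index one\<close>

text \<open>
  The tail of \<open>w / U\<close> with \<open>U\<close> uniform on the unit interval, including the degenerate case
  \<open>w = 0\<close>, where the convention \<open>0 / 0 = 0\<close> gives the right value at \<open>s = 0\<close>.
\<close>

definition pareto_tail :: "real \<Rightarrow> real \<Rightarrow> real" where
  "pareto_tail w s = (if s < 0 \<or> s < w then 1 else w / s)"

definition pareto_law :: "real \<Rightarrow> real measure" where
  "pareto_law w = distr (uniform_measure lborel {0<..<1}) borel (\<lambda>u. w / u)"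

text \<open>
  The probability that \<open>A / U + B / V\<close> exceeds \<open>1\<close> for independent uniform \<open>U\<close>, \<open>V\<close>, as a function
  of \<open>s = A + B\<close> and \<open>P = A * B\<close>. The truncation at \<open>1\<close> covers the range where the event is certain;
  for \<open>P = 0\<close> the conventions for division and logarithm by zero make the second term vanish.
\<close>

definition pareto_sum_tail :: "real \<Rightarrow> real \<Rightarrow> real" where
  "pareto_sum_tail s P = min s 1 + P * ln ((1 - min s 1 + P) / P)"

lemma pareto_tail_bounds: "0 \<le> w \<Longrightarrow> 0 \<le> pareto_tail w s \<and> pareto_tail w s \<le> 1"
  by (auto simp: pareto_tail_def divide_le_eq_1)

lemma pareto_tail_measurable [measurable]: "pareto_tail w \<in> borel_measurable borel"
  unfolding pareto_tail_def[abs_def] by measurable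

lemma prob_space_uniform_unit: "prob_space (uniform_measure lborel {0<..<1::real})"
  by (rule prob_space_uniform_measure) auto

lemma real_distribution_pareto_law: "real_distribution (pareto_law w)"
proof -
  interpret prob_space "uniform_measure lborel {0<..<1::real}" by (rule prob_space_uniform_unit)
  show ?thesis unfolding pareto_law_def by (intro real_distribution_distr) measurable
qed

lemma tail_pareto_law:
  assumes "0 \<le> w"
  shows "measure (pareto_law w) {s<..} = pareto_tail w s"
proof -
  have "measure (pareto_law w) {s<..} = measure lborel ({0<..<1} \<inter> {u. s < w / u})"
    unfolding pareto_law_def
    by (subst measure_distr) (auto simp: measure_uniform_measure vimage_def greaterThan_def)
  also have "\<dots> = pareto_tail w s"
  proof (cases "s < 0 \<or> s < w")
    case True
    have "s < w / u" if u: "0 < u" "u < 1" for u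
    proof (cases "s < 0")
      case True
      then show ?thesis using assms u by (smt (verit) divide_nonneg_pos)
    next
      case False
      then have "s * u \<le> s * 1" using u by (intro mult_left_mono) auto
      then show ?thesis using True False u by (simp add: less_divide_eq)
    qed
    then have "{0<..<1} \<inter> {u. s < w / u} = {0<..<1}" by auto
    then show ?thesis using True by (simp add: pareto_tail_def)
  next
    case False
    have "{0<..<1} \<inter> {u. s < w / u} = {0<..<w / s}"
    proof (cases "s = 0")
      case True
      then show ?thesis using False assms by auto
    next
      case s: False
      then have "s < w / u \<longleftrightarrow> u < w / s" if "0 < u" for u
        using False that by (auto simp: field_simps)
      moreover have "w / s \<le> 1" using False s by (auto simp: divide_le_eq_1)
      ultimately show ?thesis by auto
    qed
    then show ?thesis using False assms by (auto simp: pareto_tail_def)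
  qed
  finally show ?thesis .
qed

text \<open>
  Suppose \<open>A + B < 1\<close>. Below \<open>u = B / (1 - A)\<close> the integrand equals \<open>1\<close>, above it equals \<open>A u / (u - B)\<close>, whose
  primitive is \<open>A u + A B ln (u - B)\<close>.
\<close>

lemma pareto_tail_integral:
  assumes "0 \<le> A" "0 \<le> B"
  shows "((\<lambda>u. pareto_tail A (1 - B / u)) has_integral pareto_sum_tail (A + B) (A * B)) {0..1}"
proof (cases "1 \<le> A + B")
  case True
  have "((\<lambda>u::real. 1::real) has_integral 1) {0..1}"
    using has_integral_const_real[of "1::real" 0 1] by simp
  moreover have "pareto_tail A (1 - B / u) = 1" if "u \<in> {0<..<1}" for u
  proof -
    have "B \<le> B / u" using that assms by (simp add: le_divide_eq mult_left_le)
    then have "1 - B / u \<le> A" using True by simp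
    moreover have "1 - B / u < 0" if "A = 0"
    proof -
      have "B / u > B" using \<open>u \<in> _\<close> that True
        by (simp add: less_divide_eq)
      then show ?thesis using that True by simp
    qed
    ultimately show ?thesis using assms by (auto simp: pareto_tail_def)
  qed
  moreover have "pareto_sum_tail (A + B) (A * B) = 1"
    using True by (simp add: pareto_sum_tail_def min_def)
  ultimately show ?thesis
    using has_integral_spike_interior[of "\<lambda>_. 1" 1 0 1 "\<lambda>u. pareto_tail A (1 - B / u)"]
    by (simp add: box_real)
next
  case False
  define u0 where "u0 = B / (1 - A)"
  have A1: "A < 1" and B1: "B < 1" and u0: "0 \<le> u0" "u0 \<le> 1" "B \<le> u0"
    using False assms mult_nonneg_nonneg[of A B] by (auto simp: u0_def field_simps)
  have lower: "((\<lambda>u. pareto_tail A (1 - B / u)) has_integral u0) {0..u0}"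
  proof -
    have "((\<lambda>u::real. 1::real) has_integral u0) {0..u0}"
      using has_integral_const_real[of "1::real" 0 u0] u0 by simp
    moreover have "pareto_tail A (1 - B / u) = 1" if "u \<in> {0<..<u0}" for u
    proof -
      have "1 - B / u < A" using that A1 by (auto simp: u0_def field_simps)
      then show ?thesis by (simp add: pareto_tail_def)
    qed
    ultimately show ?thesis
      using has_integral_spike_interior[of "\<lambda>_. 1" u0 0 u0 "\<lambda>u. pareto_tail A (1 - B / u)"]
      by (simp add: box_real)
  qed
  have integrand: "pareto_tail A (1 - B / u) = A * (u / (u - B))" if "u \<in> {u0<..<1}" for u
  proof -
    have "0 < u" "B < u" using that u0 by auto
    moreover have "A \<le> 1 - B / u" using that A1 \<open>0 < u\<close> by (auto simp: u0_def field_simps)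
    moreover have "1 - B / u = (u - B) / u" using \<open>0 < u\<close> by (simp add: field_simps)
    moreover have "0 < 1 - B / u" using \<open>0 < u\<close> \<open>B < u\<close> by simp
    ultimately show ?thesis using assms by (simp add: pareto_tail_def)
  qed
  define G where "G u = A * u + A * B * ln (u - B)" for u
  have upper: "((\<lambda>u. pareto_tail A (1 - B / u)) has_integral (G 1 - G u0)) {u0..1}"
  proof (rule fundamental_theorem_of_calculus_interior)
    show "u0 \<le> 1" by (rule u0)
    show "continuous_on {u0..1} G"
    proof (cases "A * B = 0")
      case True
      then have "G = (\<lambda>u. A * u)" by (auto simp: G_def fun_eq_iff)
      then show ?thesis by (auto intro!: continuous_intros)
    next
      case False
      then have "B < u0" using assms A1 by (simp add: u0_def field_simps)
      then show ?thesis unfolding G_def by (auto intro!: continuous_intros)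
    qed
    fix u assume u: "u \<in> {u0<..<1}"
    then have "B < u" using u0 by auto
    then have "(G has_real_derivative A + A * B * (1 / (u - B))) (at u)"
      unfolding G_def by (auto intro!: derivative_eq_intros)
    also have "A + A * B * (1 / (u - B)) = A * (u / (u - B))"
      using \<open>B < u\<close> by (simp add: field_simps)
    finally show "(G has_vector_derivative pareto_tail A (1 - B / u)) (at u)"
      using integrand[OF u] by (simp add: has_real_derivative_iff_has_vector_derivative)
  qed
  have "u0 + (G 1 - G u0) = pareto_sum_tail (A + B) (A * B)"
  proof (cases "A * B = 0")
    case True
    then show ?thesis using False A1
      by (auto simp: G_def pareto_sum_tail_def u0_def)
  next
    case nz: False
    then have pos: "0 < A" "0 < B" using assms by auto
    have "u0 - B = A * B / (1 - A)" using A1 by (simp add: u0_def field_simps)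
    then have "ln (1 - B) - ln (u0 - B) = ln ((1 - B) * (1 - A) / (A * B))"
      using A1 B1 pos by (simp add: ln_div ln_mult)
    also have "(1 - B) * (1 - A) = 1 - (A + B) + A * B" by (simp add: algebra_simps)
    finally have l: "ln (1 - B) - ln (u0 - B) = ln ((1 - (A + B) + A * B) / (A * B))" .
    have "u0 + (G 1 - G u0) = u0 * (1 - A) + A + A * B * (ln (1 - B) - ln (u0 - B))"
      by (simp add: G_def algebra_simps)
    also have "u0 * (1 - A) = B" using A1 by (simp add: u0_def)
    finally show ?thesis using False l by (simp add: pareto_sum_tail_def)
  qed
  then show ?thesis using has_integral_combine[OF u0(1,2) lower upper] by simp
qed

lemma pareto_law_sum_tail:
  assumes w: "0 \<le> w" "0 \<le> v" and ab: "0 < a" "0 < b" and t: "0 < t"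
  shows "(\<integral>y. pareto_tail w ((t - b * y) / a) \<partial>pareto_law v)
       = pareto_sum_tail ((a * w + b * v) / t) (a * b * w * v / t\<^sup>2)"
proof -
  define A where "A = a * w / t"
  define B where "B = b * v / t"
  interpret U: prob_space "uniform_measure lborel {0<..<1::real}" by (rule prob_space_uniform_unit)
  have AB: "0 \<le> A" "0 \<le> B" using assms by (auto simp: A_def B_def)
  have scale: "pareto_tail w ((t - b * (v / u)) / a) = pareto_tail A (1 - B / u)" for u
  proof -
    have "(t - b * (v / u)) / a = (1 - B / u) * (t / a)"
      using ab t by (simp add: B_def field_simps)
    moreover have "x * (t / a) < 0 \<longleftrightarrow> x < 0" "x * (t / a) < w \<longleftrightarrow> x < A" "w / (x * (t / a)) = A / x" for x
      using ab t by (auto simp: A_def field_simps mult_less_0_iff)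
    ultimately show ?thesis by (simp only: pareto_tail_def)
  qed
  have sint: "set_integrable lborel {0<..<1} (\<lambda>u. pareto_tail A (1 - B / u))"
    unfolding set_integrable_def
    by (rule integrableI_bounded_set_indicator[where B = 1])
      (use pareto_tail_bounds[OF AB(1)] in \<open>auto\<close>)
  have "(\<integral>y. pareto_tail w ((t - b * y) / a) \<partial>pareto_law v)
      = (\<integral>u. pareto_tail A (1 - B / u) \<partial>uniform_measure lborel {0<..<1})"
    unfolding pareto_law_def by (subst integral_distr) (simp_all add: scale del: times_divide_eq_right)
  also have "uniform_measure lborel {0<..<1::real}
      = density lborel (\<lambda>u. ennreal (indicator {0<..<1} u))"
    unfolding uniform_measure_def
    by (intro arg_cong[where f = "density lborel"] ext) (simp split: split_indicator)
  also have "(\<integral>u. pareto_tail A (1 - B / u) \<partial>density lborel (\<lambda>u. ennreal (indicator {0<..<1} u)))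
      = (LINT u:{0<..<1}|lborel. pareto_tail A (1 - B / u))"
    by (subst integral_density) (auto simp: set_lebesgue_integral_def)
  also have "\<dots> = integral {0<..<1} (\<lambda>u. pareto_tail A (1 - B / u))"
    by (rule set_borel_integral_eq_integral(2)[OF sint])
  also have "\<dots> = pareto_sum_tail (A + B) (A * B)"
    using pareto_tail_integral[OF AB] has_integral_Icc_iff_Ioo integral_unique by blast
  also have "A + B = (a * w + b * v) / t" by (simp add: A_def B_def add_divide_distrib)
  also have "A * B = a * b * w * v / t\<^sup>2" by (simp add: A_def B_def power2_eq_square)
  finally show ?thesis .
qed

text \<open>
  With \<open>d = 1 - min s 1\<close> and \<open>P > 0\<close> the derivative of \<open>P ln ((d + P) / P)\<close> is
  \<open>ln ((d + P) / P) + P / (d + P) - 1\<close>, which is nonnegative by \<open>ln x \<le> x - 1\<close> for \<open>x = P / (d + P)\<close>.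
\<close>

lemma pareto_sum_tail_mono_product:
  assumes "0 \<le> P" "P \<le> P'"
  shows "pareto_sum_tail s P \<le> pareto_sum_tail s P'"
proof -
  define d where "d = 1 - min s 1"
  have d: "0 \<le> d" by (simp add: d_def)
  have "P * ln ((d + P) / P) \<le> P' * ln ((d + P') / P')"
  proof (cases "P = 0")
    case True
    have "0 \<le> ln ((d + P') / P')" if "P' > 0" using that d by (simp add: le_divide_eq)
    then show ?thesis using True assms by (cases "P' = 0") auto
  next
    case False
    then have "0 < P" using assms by simp
    have "P * (ln (d + P) - ln P) \<le> P' * (ln (d + P') - ln P')"
    proof (rule DERIV_nonneg_imp_nondecreasing[OF assms(2)])
      fix x assume "P \<le> x"
      then have x: "0 < x" using \<open>0 < P\<close> by simp
      have "ln (x / (d + x)) \<le> x / (d + x) - 1" using x d by (intro ln_le_minus_one) auto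
      then have "0 \<le> ln (d + x) - ln x + x * (1 / (d + x) - 1 / x)"
        using x d by (simp add: ln_div right_diff_distrib)
      moreover have "((\<lambda>x. x * (ln (d + x) - ln x)) has_real_derivative
          ln (d + x) - ln x + x * (1 / (d + x) - 1 / x)) (at x)"
        using x d by (auto intro!: derivative_eq_intros)
      ultimately show "\<exists>y. ((\<lambda>x. x * (ln (d + x) - ln x)) has_real_derivative y) (at x) \<and> 0 \<le> y"
        by blast
    qed
    then show ?thesis using \<open>0 < P\<close> assms d by (simp add: ln_div)
  qed
  then show ?thesis by (simp add: pareto_sum_tail_def d_def)
qed

text \<open>
  Up to \<open>s = 1\<close> the function is increasing and concave; truncating its argument by the concave
  function \<open>min s 1\<close> preserves concavity.
\<close>

lemma pareto_sum_tail_concave: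
  assumes "0 \<le> P"
  shows "concave_on UNIV (\<lambda>s. pareto_sum_tail s P)"
proof -
  define g where "g s = s + P * ln ((1 - s + P) / P)" for s
  have g_concave: "concave_on {..1} g"
  proof (cases "P = 0")
    case True
    then show ?thesis by (auto simp: g_def concave_on_iff)
  next
    case False
    then have P: "0 < P" using assms by simp
    have "concave_on {..1} (\<lambda>s. s + P * (ln (1 - s + P) - ln P))"
    proof (rule f''_le0_imp_concave)
      fix s :: real assume "s \<in> {..1}"
      then have pos: "0 < 1 - s + P" using P by auto
      show "((\<lambda>s. s + P * (ln (1 - s + P) - ln P)) has_real_derivative 1 - P / (1 - s + P)) (at s)"
        using pos by (auto intro!: derivative_eq_intros)
      show "((\<lambda>s. 1 - P / (1 - s + P)) has_real_derivative - (P / (1 - s + P)\<^sup>2)) (at s)"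
        using pos by (auto intro!: derivative_eq_intros simp: power2_eq_square)
      show "- (P / (1 - s + P)\<^sup>2) \<le> 0" using P by simp
    qed simp
    moreover have "g s = s + P * (ln (1 - s + P) - ln P)" if "s \<in> {..1}" for s
      using that P by (simp add: g_def ln_div)
    ultimately show ?thesis by (simp add: concave_on_iff convex_def)
  qed
  have g_mono: "g x \<le> g y" if "x \<le> y" "y \<le> 1" for x y
  proof (cases "P = 0")
    case True
    then show ?thesis using that by (simp add: g_def)
  next
    case False
    then have P: "0 < P" using assms by simp
    have "ln ((1 - x + P) / (1 - y + P)) \<le> (1 - x + P) / (1 - y + P) - 1"
      using P that by (intro ln_le_minus_one) auto
    also have "\<dots> = (y - x) / (1 - y + P)" using P that by (simp add: field_simps)
    finally have "P * ln ((1 - x + P) / (1 - y + P)) \<le> P * ((y - x) / (1 - y + P))"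
      using P by (intro mult_left_mono) auto
    also have "\<dots> = (P / (1 - y + P)) * (y - x)" by simp
    also have "\<dots> \<le> 1 * (y - x)"
      using P that by (intro mult_right_mono) (auto simp: divide_le_eq_1)
    finally show ?thesis using P that by (simp add: g_def ln_div algebra_simps)
  qed
  have "(1 - l) * pareto_sum_tail x P + l * pareto_sum_tail y P
      \<le> pareto_sum_tail ((1 - l) * x + l * y) P" if l: "0 \<le> l" "l \<le> 1" for l x y
  proof -
    let ?m = "(1 - l) * min x 1 + l * min y 1"
    have "(1 - l) * g (min x 1) + l * g (min y 1) \<le> g ?m"
      using g_concave l by (auto simp: concave_on_iff dest!: conjunct2 bspec[of _ _ "min x 1"] bspec[of _ _ "min y 1"]
          spec[of _ "1 - l"] spec[of _ l])
    also have "?m \<le> min ((1 - l) * x + l * y) 1"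
    proof -
      have "(1 - l) * min x 1 \<le> (1 - l) * x" "(1 - l) * min x 1 \<le> (1 - l) * 1"
        "l * min y 1 \<le> l * y" "l * min y 1 \<le> l * 1"
        using l by (intro mult_left_mono; simp)+
      then show ?thesis by simp
    qed
    then have "g ?m \<le> g (min ((1 - l) * x + l * y) 1)" by (intro g_mono) auto
    finally show ?thesis by (simp add: pareto_sum_tail_def g_def)
  qed
  then show ?thesis by (auto simp: concave_on_def intro!: convex_onI) (smt (verit) mult_minus_right)
qed

lemma concave_on_spread_le:
  fixes f :: "real \<Rightarrow> real"
  assumes "concave_on UNIV f" "x + y = x' + y'" "\<bar>x' - y'\<bar> \<le> \<bar>x - y\<bar>"
  shows "f x + f y \<le> f x' + f y'"
proof (cases "x = y")
  case True
  then show ?thesis using assms by auto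
next
  case False
  define l where "l = (x' - x) / (y - x)"
  have l: "0 \<le> l" "l \<le> 1"
    using assms False by (auto simp: l_def divide_simps abs_if split: if_splits)
  have x': "x' = (1 - l) * x + l * y"
    using False by (simp add: l_def divide_simps) (simp add: algebra_simps)
  have y': "y' = l * x + (1 - l) * y"
    using x' assms(2) by (simp add: algebra_simps)
  have "(1 - l) * f x + l * f y \<le> f x'" "l * f x + (1 - l) * f y \<le> f y'"
    unfolding x' y' using assms(1) l by (auto simp: concave_on_iff)
  then show ?thesis by (simp add: algebra_simps)
qed

text \<open>
  Moving the weights towards each other keeps the sum of the two arguments \<open>s\<close>, brings these
  arguments closer together and enlarges the common product \<open>P\<close>. Concavity in \<open>s\<close> and monotonicity
  in \<open>P\<close> both push in the same direction. Symmetrizing over the two scales is essential: in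
  general neither summand alone is monotone.
\<close>

lemma pareto_pair_transfer:
  assumes wv: "0 \<le> w" "0 \<le> v" and t: "0 < t"
    and ab: "0 < a" "0 < b" "0 < a'" "0 < b'" and sum: "a + b = a' + b'"
    and spread: "\<bar>a' - b'\<bar> \<le> \<bar>a - b\<bar>"
  shows "pareto_sum_tail ((a * w + b * v) / t) (a * b * w * v / t\<^sup>2)
       + pareto_sum_tail ((b * w + a * v) / t) (a * b * w * v / t\<^sup>2)
     \<le> pareto_sum_tail ((a' * w + b' * v) / t) (a' * b' * w * v / t\<^sup>2)
       + pareto_sum_tail ((b' * w + a' * v) / t) (a' * b' * w * v / t\<^sup>2)"
proof -
  let ?f = pareto_sum_tail
  let ?x = "(a * w + b * v) / t" and ?y = "(b * w + a * v) / t"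
  let ?x' = "(a' * w + b' * v) / t" and ?y' = "(b' * w + a' * v) / t"
  let ?P = "a * b * w * v / t\<^sup>2" and ?P' = "a' * b' * w * v / t\<^sup>2"
  have "(a' - b')\<^sup>2 \<le> (a - b)\<^sup>2" using spread by (simp add: abs_le_square_iff)
  moreover have "(x - y)\<^sup>2 = (x + y)\<^sup>2 - 4 * (x * y)" for x y :: real
    by (simp add: power2_eq_square algebra_simps)
  ultimately have "a * b \<le> a' * b'" using sum by simp
  then have "a * b * (w * v) \<le> a' * b' * (w * v)" using wv by (intro mult_right_mono) auto
  then have P: "?P \<le> ?P'" by (auto intro!: divide_right_mono simp: mult_ac)
  have P0: "0 \<le> ?P" using wv ab by simp
  have "?f ?x ?P + ?f ?y ?P \<le> ?f ?x' ?P + ?f ?y' ?P"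
  proof (rule concave_on_spread_le[OF pareto_sum_tail_concave[OF P0]])
    have "?x + ?y = (a + b) * (w + v) / t" "?x' + ?y' = (a' + b') * (w + v) / t"
      by (simp_all add: add_divide_distrib[symmetric] algebra_simps)
    then show "?x + ?y = ?x' + ?y'" using sum by simp
    have "\<bar>(c * w + d * v) / t - (d * w + c * v) / t\<bar> = \<bar>c - d\<bar> * (\<bar>w - v\<bar> / t)" for c d
    proof -
      have "(c * w + d * v) / t - (d * w + c * v) / t = (c - d) * ((w - v) / t)"
        by (simp add: diff_divide_distrib[symmetric]) (simp add: algebra_simps)
      then show ?thesis using t by (simp add: abs_mult)
    qed
    then show "\<bar>?x' - ?y'\<bar> \<le> \<bar>?x - ?y\<bar>"
      using spread t by (auto intro!: divide_right_mono mult_right_mono)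
  qed
  also have "\<dots> \<le> ?f ?x' ?P' + ?f ?y' ?P'"
    by (intro add_mono pareto_sum_tail_mono_product P P0)
  finally show ?thesis .
qed

section \<open>Laws with inversely concave tail as mixtures of Pareto laws\<close>

locale nonneg_law = real_distribution D for D :: "real measure" +
  assumes AE_nonneg: "AE x in D. 0 \<le> x"
begin

abbreviation S :: "real \<Rightarrow> real" where
  "S s \<equiv> measure D {s<..}"

lemma real_dist: "real_distribution D"
  by unfold_locales

lemma tail_antimono: "s \<le> t \<Longrightarrow> S t \<le> S s"
  by (rule finite_measure_mono) auto

lemma tail_neg: "s < 0 \<Longrightarrow> S s = 1"
  by (subst prob_eq_1) (use AE_nonneg in auto)

lemma tail_eq: "S s = 1 - cdf D s"
proof -
  have "S s = prob (space D - {..s})" by (rule arg_cong[where f = prob]) auto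
  then show ?thesis using prob_compl[of "{..s}"] by (simp add: cdf_def)
qed

lemma tail_right_cont: "(S \<longlongrightarrow> S s) (at_right s)"
proof -
  have "((\<lambda>s. 1 - cdf D s) \<longlongrightarrow> 1 - cdf D s) (at_right s)"
    using cdf_is_right_cont[of s] by (intro tendsto_intros) (simp add: continuous_within)
  then show ?thesis by (simp add: tail_eq)
qed

lemma tail_measurable [measurable]: "S \<in> borel_measurable borel"
  by (rule tail_borel_measurable[OF real_dist])

end

locale inverse_concave_law = nonneg_law +
  assumes concave: "concave_on {0<..} (\<lambda>x. S (1 / x))"
begin

text \<open>
  A nonnegative concave function \<open>h\<close> on the positive half-line has a decreasing quotient \<open>h x / x\<close>;
  substituting \<open>x = 1 / s\<close> turns this into the claim. As \<open>0\<close> is missing from the domain, the chord is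
  drawn from a point \<open>e > 0\<close> that tends to \<open>0\<close>.
\<close>

lemma times_tail_mono:
  assumes "0 < s" "s \<le> t"
  shows "s * S s \<le> t * S t"
proof (cases "s = t")
  case False
  define x where "x = 1 / t"
  define y where "y = 1 / s"
  have xy: "0 < x" "x < y" using assms False by (auto simp: x_def y_def divide_simps)
  have "(x / y) * S (1 / y) \<le> S (1 / x)"
  proof (rule tendsto_upperbound)
    show "((\<lambda>e. (x - e) / (y - e) * S (1 / y)) \<longlongrightarrow> (x / y) * S (1 / y)) (at_right 0)"
      using xy by (auto intro!: tendsto_eq_intros)
    show "\<forall>\<^sub>F e in at_right 0. (x - e) / (y - e) * S (1 / y) \<le> S (1 / x)"
      unfolding eventually_at_right_field
    proof (intro exI[of _ x] conjI allI impI)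
      fix e assume e: "0 < e" "e < x"
      let ?l = "(x - e) / (y - e)"
      have l: "0 \<le> ?l" "?l \<le> 1" using e xy by auto
      have "(1 - l) * e + l * y = e + l * (y - e)" for l by (simp add: algebra_simps)
      then have "(1 - ?l) * e + ?l * y = e + ?l * (y - e)" .
      also have "\<dots> = x" using e xy by simp
      finally have x: "(1 - ?l) * e + ?l * y = x" .
      have "(1 - ?l) * S (1 / e) + ?l * S (1 / y) \<le> S (1 / ((1 - ?l) * e + ?l * y))"
        using concave_onD[OF concave l] e xy by simp
      moreover have "0 \<le> (1 - ?l) * S (1 / e)" using l by simp
      ultimately show "?l * S (1 / y) \<le> S (1 / x)" unfolding x by linarith
    qed (use xy in auto)
  qed simp
  then show ?thesis using assms by (simp add: x_def y_def field_simps)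
qed simp

text \<open>
  The perspective \<open>s h (1 / s)\<close> of a concave function \<open>h\<close> is concave: \<open>2 / (s + t)\<close> is the average
  of \<open>1 / s\<close> and \<open>1 / t\<close> with weights \<open>s / (s + t)\<close> and \<open>t / (s + t)\<close>.
\<close>

lemma times_tail_midpoint:
  assumes "0 \<le> s" "0 < t"
  shows "s * S s + t * S t \<le> (s + t) * S ((s + t) / 2)"
proof (cases "s = 0")
  case True
  then show ?thesis using assms tail_antimono[of "t / 2" t] by simp
next
  case False
  define l where "l = t / (s + t)"
  have s: "0 < s" using False assms by simp
  have l: "0 \<le> l" "l \<le> 1" "1 - l = s / (s + t)" using s assms by (auto simp: l_def field_simps)
  have "(1 - l) * S (1 / (1 / s)) + l * S (1 / (1 / t)) \<le> S (1 / ((1 - l) * (1 / s) + l * (1 / t)))"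
    using concave_onD[OF concave l(1,2), of "1 / s" "1 / t"] s assms by simp
  also have "(1 - l) * (1 / s) + l * (1 / t) = 2 / (s + t)"
    using s assms unfolding l(3) by (simp add: l_def)
  finally have "(s / (s + t)) * S s + (t / (s + t)) * S t \<le> S ((s + t) / 2)"
    by (simp add: l(3)) (simp add: l_def)
  then have "(s + t) * ((s / (s + t)) * S s + (t / (s + t)) * S t) \<le> (s + t) * S ((s + t) / 2)"
    using s assms by (intro mult_left_mono) auto
  then show ?thesis using s assms by (simp add: distrib_left)
qed

lemma isCont_times_tail:
  assumes "0 < s"
  shows "isCont (\<lambda>s. s * S s) s"
proof -
  have "continuous_on {0<..} (\<lambda>x. S (1 / x))"
  proof -
    have "continuous_on {0<..} (\<lambda>x. - S (1 / x))"
      using concave unfolding concave_on_def by (intro convex_on_continuous) auto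
    from continuous_on_minus[OF this] show ?thesis by simp
  qed
  then have "isCont (\<lambda>x. S (1 / x)) (1 / s)"
    using assms by (simp add: continuous_on_eq_continuous_at)
  moreover have "isCont (\<lambda>s. 1 / s) s" using assms by (intro continuous_intros) auto
  ultimately have "isCont (\<lambda>s. S (1 / (1 / s))) s" by (rule isCont_o2[rotated])
  then show ?thesis by (auto intro!: continuous_intros)
qed

end

text \<open>
  Summation by parts: a piecewise linear function is the combination of the functions
  \<open>min w\<close> whose coefficients are the decrements of its slope.
\<close>

lemma telescoping_min_sum:
  fixes d :: "nat \<Rightarrow> real"
  assumes "i \<le> N"
  shows "(\<Sum>j\<le>N. (d j - d (Suc j)) * real (min j i)) = (\<Sum>k=1..i. d k) - real i * d (Suc N)"
  using assms
proof (induction N rule: dec_induct)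
  case base
  have "(\<Sum>j\<le>i. (d j - d (Suc j)) * real (min j i)) = (\<Sum>j\<le>i. (d j - d (Suc j)) * real j)"
    by (intro sum.cong) auto
  also have "\<dots> = (\<Sum>k=1..i. d k) - real i * d (Suc i)"
    by (induction i) (simp_all add: algebra_simps)
  finally show ?case .
next
  case (step N)
  have "(\<Sum>j\<le>Suc N. (d j - d (Suc j)) * real (min j i))
      = (\<Sum>k=1..i. d k) - real i * d (Suc N) + (d (Suc N) - d (Suc (Suc N))) * real i"
    using step by (simp add: min_absorb2)
  then show ?case by (simp add: algebra_simps)
qed

context inverse_concave_law
begin

text \<open>
  For \<open>s > 0\<close> the function \<open>s * pareto_tail w s\<close> is \<open>min w s\<close>, and \<open>H s = s * S s\<close> is increasing
  and concave. Hence the piecewise linear interpolation of \<open>H\<close> on a grid, continued by a constant, is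
  a combination of functions \<open>min w\<close> with nonnegative coefficients, the decrements of the slopes.
  Starting the slopes at \<open>1\<close> makes the coefficients add up to \<open>1\<close>; the weight \<open>1 - S \<delta>\<close> so placed at
  \<open>w = 0\<close> accounts for an atom at the origin.
\<close>

lemma pareto_mixture_approximation:
  shows "\<exists>N c w. (\<forall>n::nat. \<forall>j::nat. 0 \<le> c n j \<and> 0 \<le> w n j) \<and> (\<forall>n. (\<Sum>j\<le>N n. c n j) = 1) \<and>
    (\<forall>s. (\<lambda>n. \<Sum>j\<le>N n. c n j * pareto_tail (w n j) s) \<longlonglongrightarrow> S s)"
proof -
  define H where "H s = s * S s" for s
  \<comment> \<open>The mesh \<open>\<delta> n\<close> tends to \<open>0\<close> while the last knot \<open>N n * \<delta> n = n + 1\<close> tends to infinity.\<close>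
  define \<delta> where "\<delta> n = 1 / real (Suc n)" for n :: nat
  define N where "N n = Suc n * Suc n" for n :: nat
  define d where "d n j = (if j = 0 then 1 else if N n < j then 0
      else (H (real j * \<delta> n) - H (real (j - 1) * \<delta> n)) / \<delta> n)" for n j
  define c where "c n j = d n j - d n (Suc j)" for n j
  define w where "w n j = real j * \<delta> n" for n j
  have \<delta>: "0 < \<delta> n" for n by (simp add: \<delta>_def)
  have N\<delta>: "real (N n) * \<delta> n = real (Suc n)" for n
    unfolding N_def \<delta>_def of_nat_mult by simp
  have N1: "1 \<le> N n" for n by (simp add: N_def)
  have d1: "d n 1 = S (\<delta> n)" for n using \<delta>[of n] N1[of n] by (simp add: d_def H_def)
  have c_nonneg: "0 \<le> c n j" for n j
  proof -
    consider "j = 0" | "1 \<le> j" "j < N n" | "j = N n" "1 \<le> j" | "N n < j" by linarith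
    then show ?thesis
    proof cases
      case 1
      then show ?thesis using d1[of n] by (simp add: c_def d_def[of n 0])
    next
      case 2
      have "H (real (j - 1) * \<delta> n) + H (real (Suc j) * \<delta> n) \<le> 2 * H (real j * \<delta> n)"
      proof -
        have "real (j - 1) * \<delta> n + real (Suc j) * \<delta> n = 2 * (real j * \<delta> n)"
          using 2 by (simp add: algebra_simps of_nat_diff)
        then show ?thesis
          using times_tail_midpoint[of "real (j - 1) * \<delta> n" "real (Suc j) * \<delta> n"] \<delta>[of n]
          by (simp add: H_def)
      qed
      then show ?thesis using 2 \<delta>[of n] by (simp add: c_def d_def diff_divide_distrib[symmetric])
    next
      case 3
      have "H (real (j - 1) * \<delta> n) \<le> H (real j * \<delta> n)"
      proof (cases "j = 1")
        case True
        then show ?thesis using \<delta>[of n] by (simp add: H_def)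
      next
        case False
        then show ?thesis unfolding H_def using 3 \<delta>[of n]
          by (intro times_tail_mono) auto
      qed
      then show ?thesis using 3 \<delta>[of n] by (simp add: c_def d_def)
    next
      case 4
      then show ?thesis by (simp add: c_def d_def)
    qed
  qed
  have c_tail: "(\<Sum>j=1..N n. c n j) = S (\<delta> n)" for n
  proof -
    have "(\<Sum>j=1..N n. c n j) = - (\<Sum>j=1..N n. d n (Suc j) - d n j)"
      by (simp add: c_def sum_negf[symmetric])
    also have "\<dots> = d n 1 - d n (Suc (N n))"
      using N1[of n] by (subst sum_Suc_diff) auto
    finally show ?thesis using d1[of n] by (simp add: d_def[of n "Suc (N n)"])
  qed
  have split0: "(\<Sum>j\<le>N n. f j) = f 0 + (\<Sum>j=1..N n. f j)" for n and f :: "nat \<Rightarrow> real"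
    by (simp add: atMost_atLeast0 sum.atLeast_Suc_atMost)
  have c_total: "(\<Sum>j\<le>N n. c n j) = 1" for n
    unfolding split0 c_tail using d1[of n] by (simp add: c_def d_def[of n 0])
  have at_knots: "(\<Sum>j\<le>N n. c n j * min (w n j) (real i * \<delta> n)) = H (real i * \<delta> n)" if "i \<le> N n" for n i
  proof -
    have "min (w n j) (real i * \<delta> n) = real (min j i) * \<delta> n" for j
      using \<delta>[of n] by (auto simp: w_def min_def)
    then have "(\<Sum>j\<le>N n. c n j * min (w n j) (real i * \<delta> n))
        = (\<Sum>j\<le>N n. (d n j - d n (Suc j)) * real (min j i)) * \<delta> n"
      by (simp add: c_def sum_distrib_right mult.assoc)
    also have "\<dots> = (\<Sum>k=1..i. d n k) * \<delta> n"
      by (subst telescoping_min_sum[OF that]) (simp add: d_def)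
    also have "\<dots> = (\<Sum>k=1..i. H (real k * \<delta> n) - H (real (k - 1) * \<delta> n))"
      unfolding sum_distrib_right using that \<delta>[of n] by (intro sum.cong) (auto simp: d_def)
    also have "\<dots> = H (real i * \<delta> n)"
      by (induction i) (auto simp: H_def)
    finally show ?thesis .
  qed
  have \<delta>_lim: "\<delta> \<longlonglongrightarrow> 0"
    unfolding \<delta>_def using LIMSEQ_inverse_real_of_nat by (simp add: inverse_eq_divide)
  have "(\<lambda>n. \<Sum>j\<le>N n. c n j * pareto_tail (w n j) s) \<longlonglongrightarrow> S s" for s
  proof -
    consider "s < 0" | "s = 0" | "0 < s" by linarith
    then show ?thesis
    proof cases
      case 1
      then show ?thesis by (simp add: pareto_tail_def tail_neg c_total)
    next
      case 2
      have "(\<Sum>j\<le>N n. c n j * pareto_tail (w n j) 0) = S (\<delta> n)" for n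
      proof -
        have "(\<Sum>j=1..N n. c n j * pareto_tail (w n j) 0) = (\<Sum>j=1..N n. c n j)"
          using \<delta>[of n] by (intro sum.cong) (auto simp: pareto_tail_def w_def)
        then show ?thesis unfolding split0 c_tail by (simp add: pareto_tail_def w_def)
      qed
      moreover have "(\<lambda>n. S (\<delta> n)) \<longlonglongrightarrow> S 0"
        by (rule filterlim_compose[OF tail_right_cont])
          (auto simp: filterlim_at \<delta>_lim \<delta> \<delta>[THEN less_imp_neq, symmetric])
      ultimately show ?thesis using 2 by simp
    next
      case 3
      define g where "g n s = (\<Sum>j\<le>N n. c n j * min (w n j) s)" for n s
      define k where "k n = nat \<lfloor>s / \<delta> n\<rfloor>" for n
      have g_mono: "g n x \<le> g n y" if "x \<le> y" for n x y
        unfolding g_def using that by (intro sum_mono mult_left_mono c_nonneg) auto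
      have k: "real (k n) * \<delta> n \<le> s" "s \<le> real (Suc (k n)) * \<delta> n" for n
      proof -
        have "real (k n) = of_int \<lfloor>s / \<delta> n\<rfloor>" using 3 \<delta>[of n] by (simp add: k_def)
        then have "real (k n) \<le> s / \<delta> n" "s / \<delta> n \<le> real (Suc (k n))" by linarith+
        then show "real (k n) * \<delta> n \<le> s" "s \<le> real (Suc (k n)) * \<delta> n"
          using \<delta>[of n] by (simp_all add: pos_le_divide_eq pos_divide_le_eq)
      qed
      have kN: "Suc (k n) \<le> N n" if "s < real n" for n
      proof -
        have "real (k n) * \<delta> n < real (N n) * \<delta> n" using k(1)[of n] that by (simp add: N\<delta>)
        then show ?thesis using \<delta>[of n] by (simp add: mult_less_cancel_right)
      qed
      have Hcont: "isCont H s" unfolding H_def[abs_def] using 3 by (rule isCont_times_tail)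
      have lo: "(\<lambda>n. real (k n) * \<delta> n) \<longlonglongrightarrow> s"
      proof (rule tendsto_sandwich)
        show "\<forall>\<^sub>F n in sequentially. s - \<delta> n \<le> real (k n) * \<delta> n"
        proof (intro always_eventually allI)
          fix n show "s - \<delta> n \<le> real (k n) * \<delta> n" using k(2)[of n] by (simp add: distrib_right)
        qed
        show "(\<lambda>n. s - \<delta> n) \<longlonglongrightarrow> s" using tendsto_diff[OF tendsto_const \<delta>_lim, of s] by simp
        show "\<forall>\<^sub>F n in sequentially. real (k n) * \<delta> n \<le> s" using k(1) by simp
      qed (rule tendsto_const)
      have hi: "(\<lambda>n. real (Suc (k n)) * \<delta> n) \<longlonglongrightarrow> s"
      proof -
        have "real (Suc (k n)) * \<delta> n = real (k n) * \<delta> n + \<delta> n" for n by (simp add: distrib_right)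
        then show ?thesis using tendsto_add[OF lo \<delta>_lim] by (simp only: add_0_right)
      qed
      \<comment> \<open>The interpolation is monotone and agrees with \<open>H\<close> at the two knots next to \<open>s\<close>.\<close>
      have "(\<lambda>n. g n s) \<longlonglongrightarrow> H s"
      proof (rule tendsto_sandwich)
        have ev: "\<forall>\<^sub>F n in sequentially. s < real n"
          using filterlim_real_sequentially by (simp add: filterlim_at_top_dense)
        show "\<forall>\<^sub>F n in sequentially. H (real (k n) * \<delta> n) \<le> g n s"
          using ev
        proof eventually_elim
          case (elim n)
          then show ?case
            using g_mono[OF k(1)[of n], of n] at_knots[of "k n" n] kN[of n] by (simp add: g_def)
        qed
        show "\<forall>\<^sub>F n in sequentially. g n s \<le> H (real (Suc (k n)) * \<delta> n)"
          using ev
        proof eventually_elim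
          case (elim n)
          then show ?case
            using g_mono[OF k(2)[of n], of n] at_knots[of "Suc (k n)" n] kN[of n] by (simp add: g_def)
        qed
        show "(\<lambda>n. H (real (k n) * \<delta> n)) \<longlonglongrightarrow> H s"
          by (rule isCont_tendsto_compose[OF Hcont lo])
        show "(\<lambda>n. H (real (Suc (k n)) * \<delta> n)) \<longlonglongrightarrow> H s"
          by (rule isCont_tendsto_compose[OF Hcont hi])
      qed
      then have "(\<lambda>n. g n s / s) \<longlonglongrightarrow> H s / s" 
        by (rule tendsto_divide[OF _ tendsto_const]) (use 3 in simp)
      moreover have "g n s / s = (\<Sum>j\<le>N n. c n j * pareto_tail (w n j) s)" for n
      proof -
        have "min (w n j) s / s = pareto_tail (w n j) s" for j
          using 3 by (simp add: pareto_tail_def min_def)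
        then show ?thesis by (simp only: g_def sum_divide_distrib times_divide_eq_right[symmetric])
      qed
      ultimately show ?thesis using 3 by (simp add: H_def)
    qed
  qed
  moreover have "0 \<le> w n j" for n j using \<delta>[of n] by (simp add: w_def)
  ultimately show ?thesis using c_nonneg c_total
    by (intro exI[of _ N] exI[of _ c] exI[of _ w] conjI allI)
qed

text \<open>
  Both sides are linear in the law whose tail is integrated, hence an inequality for all scaled
  Pareto tails extends to their mixtures, and by dominated convergence to their limits.
\<close>

lemma pareto_mixture_principle:
  assumes "prob_space M"
    and [measurable]: "f1 \<in> borel_measurable M" "f2 \<in> borel_measurable M"
      "g1 \<in> borel_measurable M" "g2 \<in> borel_measurable M"
    and pareto: "\<And>w. 0 \<le> w \<Longrightarrow>
      (\<integral>y. pareto_tail w (f1 y) \<partial>M) + (\<integral>y. pareto_tail w (f2 y) \<partial>M)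
        \<le> (\<integral>y. pareto_tail w (g1 y) \<partial>M) + (\<integral>y. pareto_tail w (g2 y) \<partial>M)"
  shows "(\<integral>y. S (f1 y) \<partial>M) + (\<integral>y. S (f2 y) \<partial>M) \<le> (\<integral>y. S (g1 y) \<partial>M) + (\<integral>y. S (g2 y) \<partial>M)"
proof -
  interpret M: prob_space M by fact
  obtain N :: "nat \<Rightarrow> nat" and c w :: "nat \<Rightarrow> nat \<Rightarrow> real"
    where approx: "(\<forall>n j. 0 \<le> c n j \<and> 0 \<le> w n j) \<and> (\<forall>n. (\<Sum>j\<le>N n. c n j) = 1) \<and>
      (\<forall>s. (\<lambda>n. \<Sum>j\<le>N n. c n j * pareto_tail (w n j) s) \<longlonglongrightarrow> S s)"
    using pareto_mixture_approximation by (elim exE)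
  have cw: "0 \<le> c n j" "0 \<le> w n j" "(\<Sum>j\<le>N n. c n j) = 1" for n j
    using approx by auto
  have lim: "(\<lambda>n. \<Sum>j\<le>N n. c n j * pareto_tail (w n j) s) \<longlonglongrightarrow> S s" for s
    using approx by blast
  define A where "A n f = (\<Sum>j\<le>N n. c n j * (\<integral>y. pareto_tail (w n j) (f y) \<partial>M))" for n f
  have int: "integrable M (\<lambda>y. pareto_tail (w n j) (f y))" if [measurable]: "f \<in> borel_measurable M" for n j f
    using pareto_tail_bounds[OF cw(2)]
    by (intro M.integrable_const_bound[where B = 1]) auto
  have A_lim: "(\<lambda>n. A n f) \<longlonglongrightarrow> (\<integral>y. S (f y) \<partial>M)" if f [measurable]: "f \<in> borel_measurable M" for f
  proof -
    have "A n f = (\<integral>y. (\<Sum>j\<le>N n. c n j * pareto_tail (w n j) (f y)) \<partial>M)" for n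
      unfolding A_def using int[OF f] by (subst Bochner_Integration.integral_sum) auto
    moreover have "(\<lambda>n. \<integral>y. (\<Sum>j\<le>N n. c n j * pareto_tail (w n j) (f y)) \<partial>M) \<longlonglongrightarrow> (\<integral>y. S (f y) \<partial>M)"
    proof (rule integral_dominated_convergence[where w = "\<lambda>_. 1"])
      have "\<bar>\<Sum>j\<le>N n. c n j * pareto_tail (w n j) s\<bar> \<le> 1" for n s
      proof -
        have "(\<Sum>j\<le>N n. c n j * pareto_tail (w n j) s) \<le> (\<Sum>j\<le>N n. c n j * 1)"
          using pareto_tail_bounds[OF cw(2)] cw(1) by (intro sum_mono mult_left_mono) auto
        moreover have "0 \<le> (\<Sum>j\<le>N n. c n j * pareto_tail (w n j) s)"
          using pareto_tail_bounds[OF cw(2)] cw(1) by (intro sum_nonneg mult_nonneg_nonneg) auto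
        ultimately show ?thesis using cw(3) by simp
      qed
      then show "AE y in M. norm (\<Sum>j\<le>N n. c n j * pareto_tail (w n j) (f y)) \<le> 1" for n
        by simp
    qed (auto simp: lim)
    ultimately show ?thesis by simp
  qed
  have "A n f1 + A n f2 \<le> A n g1 + A n g2" for n
    unfolding A_def sum.distrib[symmetric] distrib_left[symmetric]
    by (intro sum_mono mult_left_mono pareto cw)
  then show ?thesis
    by (intro LIMSEQ_le[OF tendsto_add[OF A_lim A_lim] tendsto_add[OF A_lim A_lim]]) auto
qed

end

section \<open>Schur concavity of weighted sums in the inversely concave case\<close>

lemma tail_scale:
  assumes "real_distribution M" "0 < a"
  shows "measure (distr M borel (\<lambda>x. a * x)) {t<..} = measure M {t / a<..}"
proof -
  interpret real_distribution M by fact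
  have "(\<lambda>x. a * x) -` {t<..} = {t / a<..}" using assms(2) by (auto simp: field_simps)
  then show ?thesis by (subst measure_distr) auto
qed

lemma tail_scaled_pair:
  assumes "real_distribution M" "real_distribution N" "0 < a"
  shows "measure (distr M borel (\<lambda>x. a * x) \<star> distr N borel (\<lambda>y. b * y)) {t<..}
       = (\<integral>y. measure M {(t - b * y) / a<..} \<partial>N)"
proof -
  note [measurable] = tail_borel_measurable[OF assms(1)]
  interpret N: real_distribution N by fact
  have "measure (distr M borel (\<lambda>x. a * x) \<star> distr N borel (\<lambda>y. b * y)) {t<..}
      = (\<integral>y. measure (distr M borel (\<lambda>x. a * x)) {t - y<..} \<partial>distr N borel (\<lambda>y. b * y))"
    by (intro tail_convolution real_distribution_scale assms)
  also have "\<dots> = (\<integral>y. measure M {(t - y) / a<..} \<partial>distr N borel (\<lambda>y. b * y))"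
    by (simp only: tail_scale[OF assms(1,3)])
  also have "\<dots> = (\<integral>y. measure M {(t - b * y) / a<..} \<partial>N)"
    by (rule integral_distr) measurable
  finally show ?thesis .
qed

text \<open>
  Both sides are the tail of \<open>a X + b Y\<close>, once conditioned on \<open>Y\<close> and once on \<open>X\<close>. This exchanges
  the roles of the two laws between the two applications of the mixture principle.
\<close>

lemma integral_tail_swap:
  assumes "real_distribution M" "real_distribution N" "0 < a" "0 < b"
  shows "(\<integral>y. measure M {(t - b * y) / a<..} \<partial>N) = (\<integral>x. measure N {(t - a * x) / b<..} \<partial>M)"
  using tail_scaled_pair[OF assms(1,2,3), of b t] tail_scaled_pair[OF assms(2,1,4), of a t]
    convolution_commute[of "distr M borel (\<lambda>x. a * x)" "distr N borel (\<lambda>y. b * y)"]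
    real_distribution_scale assms by simp

lemma tail_weighted_pair:
  assumes "real_distribution D" "0 < a"
  shows "measure (weighted_sum_law D [a, b]) {t<..} = (\<integral>y. measure D {(t - b * y) / a<..} \<partial>D)"
proof -
  have "weighted_sum_law D [a, b] = (distr D borel (\<lambda>x. a * x) \<star> weighted_sum_law D [b])"
    by simp
  then show ?thesis
    using assms by (simp only: weighted_sum_law_singleton tail_scaled_pair)
qed

lemma (in nonneg_law) prob_UNIV [simp]: "prob UNIV = 1"
  using prob_space by simp

lemma nonneg_law_scale:
  assumes "nonneg_law D" "0 \<le> c"
  shows "nonneg_law (distr D borel (\<lambda>x. c * x))"
proof -
  interpret D: nonneg_law D by fact
  have "AE x in distr D borel (\<lambda>x. c * x). 0 \<le> x"
    using D.AE_nonneg assms(2) by (subst AE_distr_iff) auto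
  then show ?thesis
    by (simp add: nonneg_law_def nonneg_law_axioms_def real_distribution_scale D.real_dist)
qed

lemma nonneg_law_convolution:
  assumes "nonneg_law M" "nonneg_law N"
  shows "nonneg_law (M \<star> N)"
proof -
  interpret M: nonneg_law M by fact
  interpret N: nonneg_law N by fact
  interpret P: pair_prob_space M N ..
  have "AE x in M. AE y in N. 0 \<le> x + y"
    using M.AE_nonneg
  proof eventually_elim
    case (elim x)
    show ?case using N.AE_nonneg by eventually_elim (use elim in simp)
  qed
  then have "AE z in M \<Otimes>\<^sub>M N. 0 \<le> fst z + snd z"
  proof (intro P.AE_pair_measure)
    show "{z \<in> space (M \<Otimes>\<^sub>M N). 0 \<le> fst z + snd z} \<in> sets (M \<Otimes>\<^sub>M N)" by measurable
  qed simp
  then have "AE x in M \<star> N. 0 \<le> x"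
    unfolding convolution_def case_prod_beta by (subst AE_distr_iff) simp_all
  then show ?thesis
    by (simp add: nonneg_law_def nonneg_law_axioms_def real_distribution_convolution
        M.real_dist N.real_dist)
qed

lemma nonneg_law_weighted_sum:
  assumes "nonneg_law D" "\<forall>c\<in>set cs. 0 \<le> c"
  shows "nonneg_law (weighted_sum_law D cs)"
  using assms(2)
proof (induction cs)
  case Nil
  show ?case
    by (simp add: nonneg_law_def nonneg_law_axioms_def real_distribution_return AE_return)
next
  case (Cons c cs)
  then show ?case using assms(1) by (simp add: nonneg_law_convolution nonneg_law_scale)
qed

text \<open>
  At \<open>t = 0\<close> the inequality follows from right continuity of the tails.
\<close>

lemma st_dominated_if_pos:
  assumes "nonneg_law M" "nonneg_law N"
    and pos: "\<And>t. 0 < t \<Longrightarrow> measure M {t<..} \<le> measure N {t<..}"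
  shows "st_dominated M N"
  unfolding st_dominated_def
proof
  fix t :: real
  interpret M: nonneg_law M by fact
  interpret N: nonneg_law N by fact
  consider "t < 0" | "t = 0" | "0 < t" by linarith
  then show "measure M {t<..} \<le> measure N {t<..}"
  proof cases
    case 2
    show ?thesis unfolding 2
      by (rule tendsto_le[OF _ N.tail_right_cont M.tail_right_cont])
        (auto simp: eventually_at_right_field intro!: exI[of _ 1] pos)
  qed (auto simp: M.tail_neg N.tail_neg pos)
qed

context inverse_concave_law
begin

text \<open>
  The symmetrized inequality is extended from a pair of Pareto laws to \<open>D\<close> in one argument, the
  arguments are exchanged, and it is extended again. For two copies of \<open>D\<close> the two terms on each side
  coincide, so symmetrizing costs nothing.
\<close>

lemma two_weights_transfer_pos:
  assumes ab: "0 < a" "0 < b" "0 < a'" "0 < b'" and sum: "a + b = a' + b'"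
    and spread: "\<bar>a' - b'\<bar> \<le> \<bar>a - b\<bar>" and t: "0 < t"
  shows "measure (weighted_sum_law D [a, b]) {t<..} \<le> measure (weighted_sum_law D [a', b']) {t<..}"
proof -
  let ?P = pareto_law
  note pl = real_distribution_pareto_law
  have pareto_pareto: "(\<integral>y. pareto_tail w ((t - b * y) / a) \<partial>?P v) + (\<integral>y. pareto_tail w ((t - a * y) / b) \<partial>?P v)
     \<le> (\<integral>y. pareto_tail w ((t - b' * y) / a') \<partial>?P v) + (\<integral>y. pareto_tail w ((t - a' * y) / b') \<partial>?P v)"
    if "0 \<le> w" "0 \<le> v" for w v
    using pareto_pair_transfer[OF that t ab sum spread] that ab t
    by (simp add: pareto_law_sum_tail mult.commute[of b a] mult.commute[of b' a'])
  have D_pareto: "(\<integral>y. S ((t - b * y) / a) \<partial>?P v) + (\<integral>y. S ((t - a * y) / b) \<partial>?P v)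
     \<le> (\<integral>y. S ((t - b' * y) / a') \<partial>?P v) + (\<integral>y. S ((t - a' * y) / b') \<partial>?P v)"
    if "0 \<le> v" for v
  proof (rule pareto_mixture_principle)
    show "prob_space (?P v)" using pl by (simp add: real_distribution_def)
  qed (intro pareto_pareto that real_distribution.measurable_finite_borel[OF pl]; measurable)+
  have pareto_D: "(\<integral>y. pareto_tail v ((t - b * y) / a) \<partial>D) + (\<integral>y. pareto_tail v ((t - a * y) / b) \<partial>D)
     \<le> (\<integral>y. pareto_tail v ((t - b' * y) / a') \<partial>D) + (\<integral>y. pareto_tail v ((t - a' * y) / b') \<partial>D)"
    if "0 \<le> v" for v
    using D_pareto[OF that] integral_tail_swap[OF real_dist pl[of v]] ab that
    by (simp add: tail_pareto_law)
  have "(\<integral>y. S ((t - b * y) / a) \<partial>D) + (\<integral>y. S ((t - a * y) / b) \<partial>D)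
     \<le> (\<integral>y. S ((t - b' * y) / a') \<partial>D) + (\<integral>y. S ((t - a' * y) / b') \<partial>D)"
    by (rule pareto_mixture_principle[OF prob_space_axioms]) (measurable, rule pareto_D)
  then show ?thesis
    using integral_tail_swap[OF real_dist real_dist] ab
    by (simp add: tail_weighted_pair[OF real_dist] del: weighted_sum_law.simps)
qed

text \<open>
  A zero weight is approached by \<open>e > 0\<close>: dropping the nonnegative term \<open>e X\<close> bounds the tail of
  \<open>(b - e) Y\<close> by the right-hand side, and right continuity of the tail permits \<open>e \<rightarrow> 0\<close>.
\<close>

lemma two_weights_transfer:
  assumes ab: "0 \<le> a" "a \<le> c" "c \<le> b" "a + b = c + d"
  shows "st_dominated (weighted_sum_law D [a, b]) (weighted_sum_law D [c, d])"
proof (rule st_dominated_if_pos)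
  show "nonneg_law (weighted_sum_law D [a, b])" "nonneg_law (weighted_sum_law D [c, d])"
    using ab by (auto intro!: nonneg_law_weighted_sum nonneg_law_axioms simp del: weighted_sum_law.simps)
  fix t :: real assume t: "0 < t"
  let ?T = "\<lambda>cs. measure (weighted_sum_law D cs) {t<..}"
  consider "0 < a" | "a = 0" "c = 0" | "a = 0" "c = b" | "a = 0" "0 < c" "c < b" using ab by linarith
  then show "?T [a, b] \<le> ?T [c, d]"
  proof cases
    case 1
    then show ?thesis using ab t by (intro two_weights_transfer_pos) auto
  next
    case 2
    then show ?thesis using ab by simp
  next
    case 3
    then have "weighted_sum_law D [a, b] = weighted_sum_law D [c, d]"
      using ab by (intro weighted_sum_law_mset_cong[OF real_dist]) auto
    then show ?thesis by simp
  next
    case 4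
    have b: "0 < b" using 4 by simp
    have zero: "?T [a, b] = S (t / b)"
    proof -
      have "weighted_sum_law D [a, b] = weighted_sum_law D [b, a]"
        by (intro weighted_sum_law_mset_cong[OF real_dist]) simp
      also have "\<dots> = weighted_sum_law D [b]"
        using weighted_sum_law_zeros[OF real_dist, of "[a]" "[b]"] \<open>a = 0\<close> by simp
      finally show ?thesis
        by (simp only: weighted_sum_law_singleton[OF real_dist] tail_scale[OF real_dist b])
    qed
    have step: "S (t / (b - e)) \<le> ?T [c, d]" if e: "0 < e" "e < min c (b - c)" for e
    proof -
      have "S (t / (b - e)) \<le> (\<integral>y. S ((t - e * y) / (b - e)) \<partial>D)"
      proof -
        have "AE y in D. S (t / (b - e)) \<le> S ((t - e * y) / (b - e))"
          using AE_nonneg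
        proof eventually_elim
          case (elim y)
          then show ?case using e 4 by (intro tail_antimono divide_right_mono) auto
        qed
        then have "(\<integral>y. S (t / (b - e)) \<partial>D) \<le> (\<integral>y. S ((t - e * y) / (b - e)) \<partial>D)"
          by (intro integral_mono_AE integrable_const_bound[where B = 1]) auto
        then show ?thesis by simp
      qed
      also have "\<dots> = ?T [b - e, e]" using e 4 by (intro tail_weighted_pair[OF real_dist, symmetric]) simp
      also have "\<dots> \<le> ?T [c, d]" using e ab 4 t by (intro two_weights_transfer_pos) auto
      finally show ?thesis .
    qed
    have "((\<lambda>e. S (t / (b - e))) \<longlongrightarrow> S (t / b)) (at_right 0)"
    proof (rule filterlim_compose[OF tail_right_cont])
      have "((\<lambda>e. t / (b - e)) \<longlongrightarrow> t / b) (at_right 0)"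
        using b by (auto intro!: tendsto_eq_intros)
      moreover have "\<forall>\<^sub>F e in at_right 0. t / b < t / (b - e)"
        unfolding eventually_at_right_field
        using b t by (intro exI[of _ b]) (auto intro!: divide_strict_left_mono mult_pos_pos)
      ultimately show "filterlim (\<lambda>e. t / (b - e)) (at_right (t / b)) (at_right 0)"
        by (auto simp: filterlim_at elim!: eventually_mono)
    qed
    then show ?thesis unfolding zero
      by (rule tendsto_upperbound)
        (use step 4 in \<open>auto simp: eventually_at_right_field intro!: exI[of _ "min c (b - c)"]\<close>)
  qed
qed

lemma majorization_st_dominated:
  assumes "length ys = length xs" "sorted xs" "sorted ys"
    and "\<And>x. x \<in> set xs \<union> set ys \<Longrightarrow> 0 \<le> x"
    and "sum_list xs = sum_list ys"
    and "\<And>j. j \<le> length xs \<Longrightarrow> sum_list (take j ys) \<le> sum_list (take j xs)"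
  shows "st_dominated (weighted_sum_law D ys) (weighted_sum_law D xs)"
proof (rule majorization_induct[OF _ _ _ _ _ assms])
  fix us vs :: "real list" and a
  have "weighted_sum_law D (us @ a # vs) = weighted_sum_law D (a # us @ vs)"
    by (rule weighted_sum_law_mset_cong[OF real_dist]) simp
  then show "st_dominated (weighted_sum_law D (us @ a # vs)) (weighted_sum_law D (a # us @ vs)) \<and>
      st_dominated (weighted_sum_law D (a # us @ vs)) (weighted_sum_law D (us @ a # vs))"
    by simp
next
  fix a b c d :: real and cs
  assume "0 \<le> a" "a \<le> c" "c \<le> b" "a + b = c + d"
  then have "st_dominated (weighted_sum_law D [a, b]) (weighted_sum_law D [c, d])"
    by (rule two_weights_transfer)
  then have "st_dominated (weighted_sum_law D ([a, b] @ cs)) (weighted_sum_law D ([c, d] @ cs))"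
    unfolding weighted_sum_law_append[OF real_dist]
    by (intro convolution_mono_left real_distribution_weighted_sum_law real_dist)
  then show "st_dominated (weighted_sum_law D (a # b # cs)) (weighted_sum_law D (c # d # cs))"
    by simp
next
  fix c :: real and xs ys
  assume "st_dominated (weighted_sum_law D xs) (weighted_sum_law D ys)"
  then show "st_dominated (weighted_sum_law D (c # xs)) (weighted_sum_law D (c # ys))"
    using real_dist
    by (auto intro!: convolution_mono real_distribution_weighted_sum_law real_distribution_scale)
next
  fix xs ys zs
  assume "st_dominated (weighted_sum_law D xs) (weighted_sum_law D ys)"
    "st_dominated (weighted_sum_law D ys) (weighted_sum_law D zs)"
  then show "st_dominated (weighted_sum_law D xs) (weighted_sum_law D zs)"
    by (rule st_dominated_trans)
qed simp

end

section \<open>Weighted sums in the inversely subadditive case\<close>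

locale inverse_subadditive_law = nonneg_law +
  assumes subadditive: "0 < x \<Longrightarrow> 0 < y \<Longrightarrow> S (1 / (x + y)) \<le> S (1 / x) + S (1 / y)"
begin

text \<open>
  With \<open>\<tau> = t / (a + b)\<close>, the event \<open>a X + b Y > t\<close> contains the disjoint events that \<open>X\<close> and \<open>Y\<close>
  both exceed \<open>\<tau>\<close>, that \<open>Y \<le> \<tau>\<close> but \<open>a X > t\<close>, and that \<open>X \<le> \<tau>\<close> but \<open>b Y > t\<close>. Their total
  probability is \<open>S \<tau>\<^sup>2 + (1 - S \<tau>) (S (t / a) + S (t / b))\<close>, which is at least \<open>S \<tau>\<close> by subadditivity.
\<close>

lemma two_weights_subadditive:
  assumes ab: "0 \<le> a" "0 \<le> b"
  shows "st_dominated (weighted_sum_law D [a + b]) (weighted_sum_law D [a, b])"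
proof (rule st_dominated_if_pos)
  show "nonneg_law (weighted_sum_law D [a + b])" "nonneg_law (weighted_sum_law D [a, b])"
    using ab nonneg_law_weighted_sum[OF nonneg_law_axioms, of "[a + b]"] nonneg_law_weighted_sum[OF nonneg_law_axioms, of "[a, b]"]
    by (simp_all del: weighted_sum_law.simps)
  fix t :: real assume t: "0 < t"
  let ?T = "\<lambda>cs. measure (weighted_sum_law D cs) {t<..}"
  consider "a = 0" | "b = 0" | "0 < a" "0 < b" using ab by linarith
  then show "?T [a + b] \<le> ?T [a, b]"
  proof cases
    case 1
    have "weighted_sum_law D [a, b] = weighted_sum_law D ([b] @ [a])"
      by (intro weighted_sum_law_mset_cong[OF real_dist]) simp
    also have "\<dots> = weighted_sum_law D [b]"
      using 1 by (intro weighted_sum_law_zeros[OF real_dist]) simp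
    finally show ?thesis using 1 by simp
  next
    case 2
    have "weighted_sum_law D ([a] @ [b]) = weighted_sum_law D [a]"
      using 2 by (intro weighted_sum_law_zeros[OF real_dist]) simp
    then show ?thesis using 2 by simp
  next
    case 3
    define \<tau> where "\<tau> = t / (a + b)"
    \<comment> \<open>The conditional probability, given the second variable, that one of the three disjoint
      events occurs.\<close>
    let ?L = "\<lambda>y. S (t / a) + (S \<tau> - S (t / a)) * indicator {\<tau><..} y
                + (1 - S \<tau>) * indicator {t / b<..} y"
    have \<tau>: "0 < \<tau>" "\<tau> \<le> t / a" "\<tau> \<le> t / b"
      using 3 t by (auto simp: \<tau>_def field_simps)
    have sub: "S \<tau> \<le> S (t / a) + S (t / b)"
      using subadditive[of "a / t" "b / t"] 3 t by (simp add: \<tau>_def add_divide_distrib[symmetric])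
    have int: "integrable D (\<lambda>y. indicator {s<..} y :: real)" for s
      by (intro integrable_const_bound[where B = 1]) (auto simp: indicator_def)
    have "(\<integral>y. ?L y \<partial>D) = S (t / a) + (S \<tau> - S (t / a)) * S \<tau> + (1 - S \<tau>) * S (t / b)"
      by (simp add: int)
    also have "\<dots> = (1 - S \<tau>) * (S (t / a) + S (t / b)) + S \<tau> * S \<tau>"
      by (simp add: algebra_simps)
    finally have L: "(1 - S \<tau>) * (S (t / a) + S (t / b)) + S \<tau> * S \<tau> = (\<integral>y. ?L y \<partial>D)" ..
    have "S \<tau> = (1 - S \<tau>) * S \<tau> + S \<tau> * S \<tau>" by (simp add: algebra_simps)
    also have "\<dots> \<le> (1 - S \<tau>) * (S (t / a) + S (t / b)) + S \<tau> * S \<tau>"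
      using sub by (intro add_right_mono mult_left_mono) auto
    also have "\<dots> = (\<integral>y. ?L y \<partial>D)" by (rule L)
    also have "\<dots> \<le> (\<integral>y. S ((t - b * y) / a) \<partial>D)"
    proof (rule integral_mono_AE)
      show "AE y in D. ?L y \<le> S ((t - b * y) / a)"
        using AE_nonneg
      proof eventually_elim
        case (elim y)
        consider "y \<le> \<tau>" | "\<tau> < y" "y \<le> t / b" | "t / b < y" by linarith
        then show ?case
        proof cases
          case 1
          have "S (t / a) \<le> S ((t - b * y) / a)"
            using 3 elim by (intro tail_antimono divide_right_mono) auto
          then show ?thesis using 1 \<tau> by simp
        next
          case 2
          have "b * \<tau> \<le> b * y" using 2 3 by simp
          moreover have "t = (a + b) * \<tau>" using 3 by (simp add: \<tau>_def)
          ultimately have "t - b * y \<le> \<tau> * a" by (simp add: algebra_simps)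
          then have "(t - b * y) / a \<le> \<tau>" using 3 by (simp add: pos_divide_le_eq)
          then have "S \<tau> \<le> S ((t - b * y) / a)" by (rule tail_antimono)
          then show ?thesis using 2 by simp
        next
          case above: 3
          then have "(t - b * y) / a < 0" using 3 by (simp add: field_simps)
          then show ?thesis using above \<tau> by (simp add: tail_neg)
        qed
      qed
      show "integrable D ?L" by (simp add: int)
      show "integrable D (\<lambda>y. S ((t - b * y) / a))"
        by (intro integrable_const_bound[where B = 1]) auto
    qed
    also have "\<dots> = ?T [a, b]" using 3 by (simp only: tail_weighted_pair[OF real_dist])
    finally show ?thesis
      using 3 by (simp only: weighted_sum_law_singleton[OF real_dist] tail_scale[OF real_dist] \<tau>_def add_pos_pos)
  qed
qed

lemma subadditive_st_dominated:
  assumes "\<forall>c\<in>set cs. 0 \<le> c" "cs \<noteq> []"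
  shows "st_dominated (weighted_sum_law D [sum_list cs]) (weighted_sum_law D cs)"
  using assms
proof (induction cs)
  case (Cons c cs)
  show ?case
  proof (cases "cs = []")
    case False
    have "st_dominated (weighted_sum_law D [c + sum_list cs]) (weighted_sum_law D ([c] @ [sum_list cs]))"
      using two_weights_subadditive[of c "sum_list cs"] Cons.prems by (simp add: sum_list_nonneg)
    also have "st_dominated \<dots> (weighted_sum_law D ([c] @ cs))"
      unfolding weighted_sum_law_append[OF real_dist] using Cons False
      by (intro convolution_mono real_distribution_weighted_sum_law real_dist) auto
    finally show ?thesis by simp
  qed simp
qed simp

end

section \<open>Thinning and the compound binomial law\<close>

definition thinned_law :: "real \<Rightarrow> real measure \<Rightarrow> real measure" where
  "thinned_law p M =
     distr (measure_pmf (bernoulli_pmf p) \<Otimes>\<^sub>M M) borel (\<lambda>(b, z). if b then z else 0)"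

lemma thinning_measurable:
  assumes "sets M = sets borel"
  shows "(\<lambda>(b, z). if b then z else 0 :: real) \<in> borel_measurable (measure_pmf (bernoulli_pmf p) \<Otimes>\<^sub>M M)"
proof -
  note [measurable_cong] = assms
  show ?thesis unfolding case_prod_beta by measurable
qed

lemma real_distribution_thinned_law:
  assumes "real_distribution M"
  shows "real_distribution (thinned_law p M)"
proof -
  interpret M: real_distribution M by fact
  interpret P: pair_prob_space "measure_pmf (bernoulli_pmf p)" M ..
  show ?thesis
    unfolding thinned_law_def
    by (intro P.real_distribution_distr thinning_measurable) simp
qed

lemma integral_thinned_law:
  fixes f :: "real \<Rightarrow> 'b :: {banach, second_countable_topology}"
  assumes "real_distribution M" "0 \<le> p" "p \<le> 1"
    and [measurable]: "f \<in> borel_measurable borel" and bdd: "\<And>x. norm (f x) \<le> B"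
  shows "(\<integral>x. f x \<partial>thinned_law p M) = p *\<^sub>R (\<integral>x. f x \<partial>M) + (1 - p) *\<^sub>R f 0"
proof -
  interpret M: real_distribution M by fact
  interpret P: pair_prob_space "measure_pmf (bernoulli_pmf p)" M ..
  note [measurable] = thinning_measurable[OF M.events_eq_borel]
  have int: "integrable (measure_pmf (bernoulli_pmf p) \<Otimes>\<^sub>M M) (\<lambda>(b, z). f (if b then z else 0))"
  proof (rule P.integrable_const_bound[where B = B])
    show "(\<lambda>(b, z). f (if b then z else 0)) \<in> borel_measurable (measure_pmf (bernoulli_pmf p) \<Otimes>\<^sub>M M)"
      using measurable_compose[OF thinning_measurable[OF M.events_eq_borel] assms(4)]
      by (simp add: case_prod_beta')
  qed (simp add: bdd case_prod_beta)
  have "(\<integral>x. f x \<partial>thinned_law p M)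
      = (\<integral>z. (\<lambda>(b, z). f (if b then z else 0)) z \<partial>(measure_pmf (bernoulli_pmf p) \<Otimes>\<^sub>M M))"
    unfolding thinned_law_def by (subst integral_distr) (auto simp: case_prod_beta')
  also have "\<dots> = (\<integral>b. (\<integral>z. f (if b then z else 0) \<partial>M) \<partial>measure_pmf (bernoulli_pmf p))"
    using P.integral_fst'[OF int] by simp
  also have "\<dots> = (\<Sum>b\<in>UNIV. pmf (bernoulli_pmf p) b *\<^sub>R (\<integral>z. f (if b then z else 0) \<partial>M))"
    by (rule integral_measure_pmf) auto
  also have "\<dots> = p *\<^sub>R (\<integral>x. f x \<partial>M) + (1 - p) *\<^sub>R f 0"
    using assms(2,3) M.prob_space by (simp add: UNIV_bool)
  finally show ?thesis .
qed

lemma tail_thinned_law: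
  assumes "real_distribution M" "0 \<le> p" "p \<le> 1"
  shows "measure (thinned_law p M) {t<..} = p * measure M {t<..} + (1 - p) * indicator {t<..} 0"
proof -
  interpret M: real_distribution M by fact
  interpret T: real_distribution "thinned_law p M" by (rule real_distribution_thinned_law) fact
  have "measure (thinned_law p M) {t<..} = (\<integral>x. indicator {t<..} x \<partial>thinned_law p M)" by simp
  also have "\<dots> = p *\<^sub>R (\<integral>x. indicator {t<..} x \<partial>M) + (1 - p) *\<^sub>R indicator {t<..} 0"
    by (rule integral_thinned_law[where B = 1, OF assms]) (auto simp: indicator_def)
  finally show ?thesis by simp
qed

lemma char_thinned_law:
  assumes "real_distribution M" "0 \<le> p" "p \<le> 1"
  shows "char (thinned_law p M) t = of_real p * char M t + of_real (1 - p)"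
proof -
  have "char (thinned_law p M) t = p *\<^sub>R (\<integral>x. iexp (t * x) \<partial>M) + (1 - p) *\<^sub>R iexp (t * 0)"
    unfolding char_def by (rule integral_thinned_law[where B = 1, OF assms]) simp_all
  then show ?thesis by (simp add: char_def scaleR_conv_of_real)
qed

lemma nonneg_law_thinned:
  assumes "nonneg_law M" "0 \<le> p" "p \<le> 1"
  shows "nonneg_law (thinned_law p M)"
proof -
  interpret M: nonneg_law M by fact
  interpret P: pair_prob_space "measure_pmf (bernoulli_pmf p)" M ..
  have "AE z in measure_pmf (bernoulli_pmf p) \<Otimes>\<^sub>M M. 0 \<le> (if fst z then snd z else 0)"
  proof (rule P.AE_pair_measure)
    show "{z \<in> space (measure_pmf (bernoulli_pmf p) \<Otimes>\<^sub>M M). 0 \<le> (if fst z then snd z else 0)}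
        \<in> sets (measure_pmf (bernoulli_pmf p) \<Otimes>\<^sub>M M)"
      by measurable
    show "AE b in measure_pmf (bernoulli_pmf p). AE z in M. 0 \<le> (if fst (b, z) then snd (b, z) else 0)"
    proof (rule always_eventually, rule allI)
      fix b
      show "AE z in M. 0 \<le> (if fst (b, z) then snd (b, z) else 0)"
        using M.AE_nonneg by eventually_elim simp
    qed
  qed
  then have "AE x in thinned_law p M. 0 \<le> x"
    unfolding thinned_law_def
    by (subst AE_distr_iff) (auto simp: case_prod_beta' thinning_measurable[unfolded case_prod_beta'])
  then show ?thesis
    by (simp add: nonneg_law_def nonneg_law_axioms_def real_distribution_thinned_law M.real_dist)
qed

text \<open>
  Conditioning on \<open>N\<close>, the binomial theorem sums the characteristic function to
  \<open>(p \<phi> t + 1 - p) ^ m\<close>, the \<open>m\<close>-th power of that of the thinned law.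
\<close>

lemma compound_binomial_eq:
  assumes F: "real_distribution (interval_measure F)" and p: "0 < p" "p < 1"
  shows "compound_binomial m p F
       = weighted_sum_law (thinned_law p (interval_measure F)) (replicate m 1)"
proof (rule Levy_uniqueness)
  let ?M = "interval_measure F"
  let ?B = "measure_pmf (binomial_pmf m p)"
  let ?Z = "\<Pi>\<^sub>M i\<in>{1::nat..}. ?M"
  let ?f = "\<lambda>(N, Z). \<Sum>i=1..N. Z i"
  note T = real_distribution_thinned_law[OF F, of p]
  interpret M: real_distribution ?M by fact
  interpret Z: product_prob_space "\<lambda>_. ?M" "{1::nat..}" ..
  interpret P: pair_prob_space ?B ?Z ..
  have comp: "(\<lambda>Z. \<Sum>i=1..N. Z i) \<in> borel_measurable ?Z" for N :: nat
  proof (rule borel_measurable_sum)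
    fix i assume "i \<in> {1..N}"
    then show "(\<lambda>Z. Z i) \<in> borel_measurable ?Z"
      using measurable_component_singleton[of i "{1::nat..}" "\<lambda>_. ?M"] by simp
  qed
  have meas: "?f \<in> borel_measurable (?B \<Otimes>\<^sub>M ?Z)"
  proof -
    have "?f \<in> borel_measurable (count_space UNIV \<Otimes>\<^sub>M ?Z)"
      by (rule measurable_pair_measure_countable1) (auto simp: comp)
    then show ?thesis
      by (simp cong: measurable_cong_sets add: sets_pair_measure_cong)
  qed
  show "real_distribution (compound_binomial m p F)"
    unfolding compound_binomial_def by (rule P.real_distribution_distr) (rule meas)
  show "real_distribution (weighted_sum_law (thinned_law p ?M) (replicate m 1))"
    by (rule real_distribution_weighted_sum_law) (rule T)
  have "char (compound_binomial m p F) t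
      = char (weighted_sum_law (thinned_law p ?M) (replicate m 1)) t" for t
  proof -
    have inner: "(\<integral>Z. iexp (t * ?f (N, Z)) \<partial>?Z) = char ?M t ^ N" for N
    proof -
      have "(\<integral>Z. iexp (t * ?f (N, Z)) \<partial>?Z) = char (distr ?Z borel (\<lambda>Z. \<Sum>i=1..N. 1 * Z i)) t"
        unfolding char_def using comp[of N] by (subst integral_distr) simp_all
      also have "\<dots> = (\<Prod>i=1..N. char ?M (1 * t))"
        by (rule char_sum_coordinates[OF F]) auto
      finally show ?thesis by simp
    qed
    have int: "integrable (?B \<Otimes>\<^sub>M ?Z) (\<lambda>x. iexp (t * ?f x))"
      using meas by (intro P.integrable_const_bound[where B = 1]) simp_all
    have "char (compound_binomial m p F) t = (\<integral>x. iexp (t * ?f x) \<partial>(?B \<Otimes>\<^sub>M ?Z))"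
      unfolding char_def compound_binomial_def by (rule integral_distr[OF meas]) simp
    also have "\<dots> = (\<integral>N. (\<integral>Z. iexp (t * ?f (N, Z)) \<partial>?Z) \<partial>?B)"
      by (rule P.integral_fst'[OF int, symmetric])
    also have "\<dots> = (\<integral>N. char ?M t ^ N \<partial>?B)" by (simp only: inner)
    also have "\<dots> = (\<Sum>k\<le>m. (real (m choose k) * p ^ k * (1 - p) ^ (m - k)) *\<^sub>R char ?M t ^ k)"
      using p by (subst expectation_binomial_pmf') auto
    also have "\<dots> = (of_real p * char ?M t + of_real (1 - p)) ^ m"
      by (simp add: binomial_ring scaleR_conv_of_real power_mult_distrib mult_ac)
    also have "\<dots> = char (weighted_sum_law (thinned_law p ?M) (replicate m 1)) t"
      using p by (simp add: char_weighted_sum_law[OF T] char_thinned_law[OF F]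
          map_replicate_const prod_list_replicate)
    finally show ?thesis .
  qed
  then show "char (compound_binomial m p F)
      = char (weighted_sum_law (thinned_law p ?M) (replicate m 1))" by (rule ext)
qed

section \<open>Small thinning probabilities\<close>

text \<open>
  The first summand is absent with probability \<open>1 - p\<close> and otherwise distributed as \<open>c Z\<close>.
\<close>

lemma tail_weighted_sum_thinned_Cons:
  assumes M: "real_distribution M" and p: "0 \<le> p" "p \<le> 1"
  shows "measure (weighted_sum_law (thinned_law p M) (c # cs)) {t<..}
    = p * (\<integral>z. measure (weighted_sum_law (thinned_law p M) cs) {t - c * z<..} \<partial>M)
      + (1 - p) * measure (weighted_sum_law (thinned_law p M) cs) {t<..}"
proof -
  let ?T = "thinned_law p M"
  let ?W = "weighted_sum_law ?T cs"
  note T = real_distribution_thinned_law[OF M, of p]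
  note W = real_distribution_weighted_sum_law[OF T, of cs]
  interpret T: real_distribution ?T by (rule T)
  interpret W: real_distribution ?W by (rule W)
  note [measurable] = tail_borel_measurable[OF W]
  have "measure (weighted_sum_law ?T (c # cs)) {t<..} = measure (?W \<star> distr ?T borel (\<lambda>x. c * x)) {t<..}"
    using convolution_commute[OF real_distribution_scale[OF T] W] by simp
  also have "\<dots> = (\<integral>y. measure ?W {t - y<..} \<partial>distr ?T borel (\<lambda>x. c * x))"
    by (rule tail_convolution[OF W real_distribution_scale[OF T]])
  also have "\<dots> = (\<integral>z. measure ?W {t - c * z<..} \<partial>?T)"
    by (rule integral_distr) measurable
  also have "\<dots> = p *\<^sub>R (\<integral>z. measure ?W {t - c * z<..} \<partial>M) + (1 - p) *\<^sub>R measure ?W {t - c * 0<..}"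
    by (rule integral_thinned_law[where B = 1, OF M p]) auto
  finally show ?thesis by simp
qed

text \<open>
  Stated without dividing by \<open>c\<close>, so that a zero weight contributes \<open>0\<close> whenever \<open>t \<ge> 0\<close>.
\<close>

definition scaled_tail :: "real measure \<Rightarrow> real \<Rightarrow> real \<Rightarrow> real" where
  "scaled_tail M t c = measure M {z. t < c * z}"

lemma scaled_tail_pos: "0 < c \<Longrightarrow> scaled_tail M t c = measure M {t / c<..}"
proof -
  assume "0 < c"
  then have "{z. t < c * z} = {t / c<..}" by (auto simp: pos_divide_less_eq mult.commute)
  then show ?thesis by (simp add: scaled_tail_def)
qed

text \<open>
  A positive sum needs at least one summand that is not thinned away.
\<close>

lemma weighted_sum_thinned_nonzero_tendsto:
  assumes M: "nonneg_law M"
  shows "((\<lambda>p. measure (weighted_sum_law (thinned_law p M) cs) {0<..}) \<longlongrightarrow> 0) (at_right 0)"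
proof (induction cs)
  case Nil
  show ?case by (simp add: measure_return)
next
  case (Cons c cs)
  interpret M: nonneg_law M by fact
  let ?W = "\<lambda>p. weighted_sum_law (thinned_law p M) cs"
  have "((\<lambda>p. p + measure (?W p) {0<..}) \<longlongrightarrow> 0 + 0) (at_right 0)"
    by (intro tendsto_add Cons) (auto intro!: tendsto_eq_intros)
  then have upper: "((\<lambda>p. p + measure (?W p) {0<..}) \<longlongrightarrow> 0) (at_right 0)" by simp
  have bound: "measure (weighted_sum_law (thinned_law p M) (c # cs)) {0<..} \<le> p + measure (?W p) {0<..}"
    if p: "0 < p" "p < 1" for p
  proof -
    note W = real_distribution_weighted_sum_law[OF real_distribution_thinned_law[OF M.real_dist, of p], of cs]
    interpret W: real_distribution "?W p" by (rule W)
    note [measurable] = tail_borel_measurable[OF W]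
    have "(\<integral>z. measure (?W p) {0 - c * z<..} \<partial>M) \<le> (\<integral>z. 1 \<partial>M)"
      by (intro integral_mono M.integrable_const_bound[where B = 1]) auto
    then have "p * (\<integral>z. measure (?W p) {0 - c * z<..} \<partial>M) \<le> p * 1"
      using p by (intro mult_left_mono) auto
    moreover have "(1 - p) * measure (?W p) {0<..} \<le> 1 * measure (?W p) {0<..}"
      using p by (intro mult_right_mono) auto
    ultimately show ?thesis
      unfolding tail_weighted_sum_thinned_Cons[OF M.real_dist less_imp_le[OF p(1)] less_imp_le[OF p(2)]]
      by linarith
  qed
  show ?case
  proof (rule tendsto_sandwich[OF _ _ tendsto_const upper])
    show "\<forall>\<^sub>F p in at_right 0. measure (weighted_sum_law (thinned_law p M) (c # cs)) {0<..}
        \<le> p + measure (?W p) {0<..}"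
      unfolding eventually_at_right_field by (intro exI[of _ 1]) (use bound in auto)
  qed simp
qed

text \<open>
  To first order in \<open>p\<close> only one summand is present. In the recursion on the first summand, the
  remaining sum differs from \<open>0\<close> with vanishing probability, so the first summand, when present,
  exceeds \<open>t\<close> on its own up to an error that tends to \<open>0\<close>.
\<close>

lemma weighted_sum_thinned_derivative:
  assumes M: "nonneg_law M" and t: "0 < t" and cs: "\<forall>c\<in>set cs. 0 \<le> c"
  shows "((\<lambda>p. measure (weighted_sum_law (thinned_law p M) cs) {t<..} / p)
    \<longlongrightarrow> (\<Sum>c\<leftarrow>cs. scaled_tail M t c)) (at_right 0)"
  using cs
proof (induction cs)
  case Nil
  show ?case using t by (simp add: measure_return)
next
  case (Cons c cs)
  interpret M: nonneg_law M by fact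
  let ?W = "\<lambda>p. weighted_sum_law (thinned_law p M) cs"
  let ?I = "\<lambda>p. \<integral>z. measure (?W p) {t - c * z<..} \<partial>M"
  have [measurable]: "{z. t < c * z} \<in> sets borel" by measurable
  have st: "scaled_tail M t c = (\<integral>z. indicator {z. t < c * z} z \<partial>M)"
    by (simp add: scaled_tail_def)
  have bounds: "scaled_tail M t c \<le> ?I p \<and> ?I p \<le> scaled_tail M t c + measure (?W p) {0<..}"
    if p: "0 < p" "p < 1" for p
  proof -
    interpret W: nonneg_law "?W p"
      using nonneg_law_thinned[OF M, of p] p Cons.prems by (intro nonneg_law_weighted_sum) auto
    have int: "integrable M (\<lambda>z. measure (?W p) {t - c * z<..})"
      "integrable M (\<lambda>z. indicator {z. t < c * z} z :: real)"
      by (intro M.integrable_const_bound[where B = 1]; simp add: indicator_def)+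
    have "indicator {z. t < c * z} z \<le> measure (?W p) {t - c * z<..}" for z
      by (auto simp: indicator_def W.tail_neg)
    moreover have "measure (?W p) {t - c * z<..} \<le> indicator {z. t < c * z} z + measure (?W p) {0<..}" for z
      using W.tail_antimono[of 0 "t - c * z"] W.prob_le_1[of "{t - c * z<..}"]
      by (auto simp: indicator_def add_increasing2)
    ultimately have "(\<integral>z. indicator {z. t < c * z} z \<partial>M) \<le> ?I p"
      "?I p \<le> (\<integral>z. indicator {z. t < c * z} z + measure (?W p) {0<..} \<partial>M)"
      using int by (intro integral_mono integrable_add; simp)+
    then show ?thesis using int st by simp
  qed
  have I: "(?I \<longlongrightarrow> scaled_tail M t c) (at_right 0)"
  proof (rule tendsto_sandwich[OF _ _ tendsto_const])
    show "((\<lambda>p. scaled_tail M t c + measure (?W p) {0<..}) \<longlongrightarrow> scaled_tail M t c) (at_right 0)"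
      using tendsto_add[OF tendsto_const weighted_sum_thinned_nonzero_tendsto[OF M]] by fastforce
  qed (use bounds in \<open>auto simp: eventually_at_right_field intro!: exI[of _ 1]\<close>)
  have "((\<lambda>p. ?I p + (1 - p) * (measure (?W p) {t<..} / p))
      \<longlongrightarrow> scaled_tail M t c + (1 - 0) * (\<Sum>c\<leftarrow>cs. scaled_tail M t c)) (at_right 0)"
    using Cons by (intro tendsto_add tendsto_mult tendsto_diff I) auto
  then have "((\<lambda>p. ?I p + (1 - p) * (measure (?W p) {t<..} / p))
      \<longlongrightarrow> (\<Sum>c\<leftarrow>c # cs. scaled_tail M t c)) (at_right 0)" by simp
  then show ?case
  proof (rule Lim_transform_eventually)
    show "\<forall>\<^sub>F p in at_right 0. ?I p + (1 - p) * (measure (?W p) {t<..} / p)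
        = measure (weighted_sum_law (thinned_law p M) (c # cs)) {t<..} / p"
      unfolding eventually_at_right_field
      by (intro exI[of _ 1])
        (auto simp: tail_weighted_sum_thinned_Cons[OF M.real_dist] add_divide_distrib
          simp del: weighted_sum_law.simps)
  qed
qed

text \<open>
  Both tails are divided by \<open>p\<close> before letting \<open>p\<close> tend to \<open>0\<close>; the \<open>m\<close>-fold repetition of the
  weights multiplies both limits by \<open>m\<close>.
\<close>

lemma scaled_tail_sum_mono_if_dominated:
  assumes M: "nonneg_law M" and m: "0 < m"
    and nonneg: "\<forall>c\<in>set cs. 0 \<le> c" "\<forall>d\<in>set ds. 0 \<le> d" and t: "0 < t"
    and dom: "\<And>p. 0 < p \<Longrightarrow> p < 1 \<Longrightarrow>
      st_dominated (weighted_sum_law (thinned_law p M) (concat (replicate m cs)))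
        (weighted_sum_law (thinned_law p M) (concat (replicate m ds)))"
  shows "(\<Sum>c\<leftarrow>cs. scaled_tail M t c) \<le> (\<Sum>d\<leftarrow>ds. scaled_tail M t d)"
proof -
  have sum: "(\<Sum>c\<leftarrow>concat (replicate m xs). scaled_tail M t c) = real m * (\<Sum>c\<leftarrow>xs. scaled_tail M t c)" for xs
    by (induction m) (auto simp: algebra_simps)
  have "(\<Sum>c\<leftarrow>concat (replicate m cs). scaled_tail M t c) \<le> (\<Sum>c\<leftarrow>concat (replicate m ds). scaled_tail M t c)"
  proof (rule tendsto_le)
    show "((\<lambda>p. measure (weighted_sum_law (thinned_law p M) (concat (replicate m cs))) {t<..} / p)
        \<longlongrightarrow> (\<Sum>c\<leftarrow>concat (replicate m cs). scaled_tail M t c)) (at_right 0)"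
      using nonneg(1) by (intro weighted_sum_thinned_derivative[OF M t]) auto
    show "((\<lambda>p. measure (weighted_sum_law (thinned_law p M) (concat (replicate m ds))) {t<..} / p)
        \<longlongrightarrow> (\<Sum>c\<leftarrow>concat (replicate m ds). scaled_tail M t c)) (at_right 0)"
      using nonneg(2) by (intro weighted_sum_thinned_derivative[OF M t]) auto
    show "\<forall>\<^sub>F p in at_right 0.
        measure (weighted_sum_law (thinned_law p M) (concat (replicate m cs))) {t<..} / p
        \<le> measure (weighted_sum_law (thinned_law p M) (concat (replicate m ds))) {t<..} / p"
      unfolding eventually_at_right_field
      using dom by (intro exI[of _ 1]) (auto simp: st_dominated_def intro!: divide_right_mono)
  qed simp
  then show ?thesis using m by (simp add: sum)
qed

section \<open>Monotone midpoint concave functions\<close>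

text \<open>
  Midpoint concavity gives the inequality for dyadic weights. A real weight is approximated by
  dyadic ones from the side where monotonicity keeps the values of \<open>h\<close> below the value at the limit.
\<close>

lemma concave_on_midpoint_mono:
  fixes h :: "real \<Rightarrow> real"
  assumes mono: "\<And>x y. 0 < x \<Longrightarrow> x \<le> y \<Longrightarrow> h x \<le> h y"
    and mid: "\<And>x y. 0 < x \<Longrightarrow> 0 < y \<Longrightarrow> h x + h y \<le> 2 * h ((x + y) / 2)"
  shows "concave_on {0<..} h"
proof -
  have dyadic: "(1 - l) * h x + l * h y \<le> h ((1 - l) * x + l * y)"
    if "l = real j / 2 ^ k" "j \<le> 2 ^ k" "0 < x" "0 < y" for j k :: nat and l x y
    using that
  proof (induction k arbitrary: j l)
    case 0
    then have "l = 0 \<or> l = 1" by (auto simp: le_Suc_eq)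
    then show ?case by auto
  next
    case (Suc k)
    note xy = \<open>0 < x\<close> \<open>0 < y\<close>
    have seg: "0 < (1 - r) * x + r * y" if "0 \<le> r" "r \<le> 1" for r
    proof (cases "r = 1")
      case False
      then show ?thesis using that xy by (intro add_pos_nonneg mult_pos_pos) auto
    qed (use xy in simp)
    show ?case
    proof (cases "j \<le> 2 ^ k")
      case True
      define r where "r = real j / 2 ^ k"
      have r: "0 \<le> r" "r \<le> 1" "l = r / 2" using True Suc.prems(1) by (auto simp: r_def field_simps)
      have "(1 - r) * h x + r * h y \<le> h ((1 - r) * x + r * y)"
        by (rule Suc.IH[OF r_def True xy])
      moreover have "h x + h ((1 - r) * x + r * y) \<le> 2 * h ((x + ((1 - r) * x + r * y)) / 2)"
        using seg[OF r(1,2)] xy by (intro mid)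
      moreover have "(x + ((1 - r) * x + r * y)) / 2 = (1 - l) * x + l * y"
        unfolding r(3) by (simp add: field_simps)
      ultimately have "h x + ((1 - r) * h x + r * h y) \<le> 2 * h ((1 - l) * x + l * y)"
        by simp
      then show ?thesis unfolding r(3) by (simp add: algebra_simps)
    next
      case False
      define i where "i = j - 2 ^ k"
      define r where "r = real i / 2 ^ k"
      have i: "i \<le> 2 ^ k" "real i = real j - 2 ^ k"
        using False Suc.prems(2) by (auto simp: i_def of_nat_diff)
      have r: "0 \<le> r" "r \<le> 1" using i(1) by (auto simp: r_def)
      have "2 * l = 1 + r" using Suc.prems(1) unfolding r_def i(2) by (simp add: field_simps)
      then have l: "l = (1 + r) / 2" by simp
      have "(1 - r) * h x + r * h y \<le> h ((1 - r) * x + r * y)"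
        by (rule Suc.IH[OF r_def i(1) xy])
      moreover have "h ((1 - r) * x + r * y) + h y \<le> 2 * h ((((1 - r) * x + r * y) + y) / 2)"
        using seg[OF r] xy by (intro mid)
      moreover have "(((1 - r) * x + r * y) + y) / 2 = (1 - l) * x + l * y"
        unfolding l by (simp add: field_simps)
      ultimately have "((1 - r) * h x + r * h y) + h y \<le> 2 * h ((1 - l) * x + l * y)"
        by simp
      then show ?thesis unfolding l by (simp add: field_simps)
    qed
  qed
  have real_weight: "(1 - l) * h x + l * h y \<le> h ((1 - l) * x + l * y)"
    if l: "0 < l" "l < 1" and xy: "0 < x" "x < y" for l x y
  proof -
    define r where "r k = real (nat \<lfloor>l * 2 ^ k\<rfloor>) / 2 ^ k" for k :: nat
    have floor: "real (nat \<lfloor>l * 2 ^ k\<rfloor>) \<le> l * 2 ^ k \<and> l * 2 ^ k \<le> real (nat \<lfloor>l * 2 ^ k\<rfloor>) + 1" for k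
    proof -
      have "real (nat \<lfloor>l * 2 ^ k\<rfloor>) = of_int \<lfloor>l * 2 ^ k\<rfloor>" using l by simp
      then show ?thesis by linarith
    qed
    have r_le: "r k \<le> l" and r0: "0 \<le> r k" for k
      using floor[of k] by (auto simp: r_def pos_divide_le_eq)
    have r_ge: "l - (1 / 2) ^ k \<le> r k" for k
    proof -
      have "l - (1 / 2) ^ k = (l * 2 ^ k - 1) / 2 ^ k" by (simp add: power_one_over field_simps)
      also have "\<dots> \<le> r k" unfolding r_def using floor[of k] by (intro divide_right_mono) auto
      finally show ?thesis .
    qed
    have "nat \<lfloor>l * 2 ^ k\<rfloor> \<le> 2 ^ k" for k
    proof -
      have "l * 2 ^ k \<le> 1 * 2 ^ k" using l by (intro mult_right_mono) auto
      then have "real (nat \<lfloor>l * 2 ^ k\<rfloor>) \<le> 1 * 2 ^ k" using floor[of k] by linarith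
      also have "\<dots> = real (2 ^ k)" by simp
      finally show ?thesis by (simp only: of_nat_le_iff)
    qed
    then have step: "(1 - r k) * h x + r k * h y \<le> h ((1 - r k) * x + r k * y)" for k
      using dyadic[of "r k" "nat \<lfloor>l * 2 ^ k\<rfloor>" k x y] xy by (simp add: r_def)
    have r_lim: "r \<longlonglongrightarrow> l"
    proof (rule tendsto_sandwich)
      have "(\<lambda>k. l - (1 / 2) ^ k) \<longlonglongrightarrow> l - 0"
        by (intro tendsto_diff tendsto_const LIMSEQ_power_zero) simp
      then show "(\<lambda>k. l - (1 / 2) ^ k) \<longlonglongrightarrow> l" by simp
      show "\<forall>\<^sub>F k in sequentially. l - (1 / 2) ^ k \<le> r k" using r_ge by simp
      show "\<forall>\<^sub>F k in sequentially. r k \<le> l" using r_le by simp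
    qed (rule tendsto_const)
    have "(\<lambda>k. (1 - r k) * h x + r k * h y) \<longlonglongrightarrow> (1 - l) * h x + l * h y"
      by (intro tendsto_add tendsto_mult tendsto_diff tendsto_const r_lim)
    then show ?thesis
    proof (rule LIMSEQ_le_const2)
      show "\<exists>N. \<forall>k\<ge>N. (1 - r k) * h x + r k * h y \<le> h ((1 - l) * x + l * y)"
      proof (intro exI[of _ 0] allI impI)
        fix k
        have "r k * (y - x) \<le> l * (y - x)" using r_le[of k] xy by (intro mult_right_mono) auto
        then have "(1 - r k) * x + r k * y \<le> (1 - l) * x + l * y" by (simp add: algebra_simps)
        moreover have "0 < (1 - r k) * x + r k * y"
          using r_le[of k] r0[of k] l xy by (intro add_pos_nonneg mult_pos_pos) auto
        ultimately show "(1 - r k) * h x + r k * h y \<le> h ((1 - l) * x + l * y)"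
          using step[of k] mono by (meson order_trans)
      qed
    qed
  qed
  show ?thesis unfolding concave_on_def
  proof (rule convex_on_linorderI)
    fix t x y :: real
    assume "0 < t" "t < 1" "x \<in> {0<..}" "y \<in> {0<..}" "x < y"
    then show "- h ((1 - t) *\<^sub>R x + t *\<^sub>R y) \<le> (1 - t) * - h x + t * - h y"
      using real_weight[of t x y] by simp
  qed simp
qed

section \<open>Diversification of compound binomial variables\<close>

lemma interval_measure_nonneg_law:
  assumes "distribution_function F" "(F \<longlongrightarrow> 0) (at_left 0)"
  shows "nonneg_law (interval_measure F)"
    and "measure (interval_measure F) {t<..} = survival F t"
proof -
  let ?M = "interval_measure F"
  have F: "\<And>x y. x \<le> y \<Longrightarrow> F x \<le> F y" "\<And>x. continuous (at_right x) F"
    "(F \<longlongrightarrow> 0) at_bot" "(F \<longlongrightarrow> 1) at_top"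
    using assms(1) by (auto simp: distribution_function_def monoD)
  interpret real_distribution ?M by (rule real_distribution_interval_measure) (use F in auto)
  have cdf: "cdf ?M = F" by (rule cdf_interval_measure) (use F in auto)
  have "measure ?M {..<0} = 0"
    using cdf_at_left[of 0] assms(2) unfolding cdf by (rule tendsto_unique[rotated]) simp
  then have "AE x in ?M. x \<notin> {..<0}" by (intro AE_not_in) (simp add: null_sets_def emeasure_eq_measure)
  then show "nonneg_law ?M"
    by unfold_locales (auto elim!: eventually_mono)
  then interpret N: nonneg_law ?M .
  show "measure ?M {t<..} = survival F t"
    by (simp add: N.tail_eq cdf survival_def)
qed

lemma thinned_inverse_concave:
  assumes "nonneg_law M" "0 \<le> p" "p \<le> 1" "concave_on {0<..} (\<lambda>x. measure M {1 / x<..})"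
  shows "inverse_concave_law (thinned_law p M)"
proof -
  interpret M: nonneg_law M by fact
  interpret T: nonneg_law "thinned_law p M" by (rule nonneg_law_thinned) fact+
  have "concave_on {0<..} (\<lambda>x. p * measure M {1 / x<..})"
    using assms(2,4) by (rule concave_on_cmul)
  moreover have tail: "measure (thinned_law p M) {1 / x<..} = p * measure M {1 / x<..}" if "0 \<le> x" for x
    using that by (simp add: tail_thinned_law[OF M.real_dist assms(2,3)])
  ultimately have "concave_on {0<..} (\<lambda>x. measure (thinned_law p M) {1 / x<..})"
    unfolding concave_on_iff by (force simp: tail)
  then show ?thesis by unfold_locales
qed

lemma thinned_inverse_subadditive:
  assumes "nonneg_law M" "0 \<le> p" "p \<le> 1"
    and "\<And>x y. 0 < x \<Longrightarrow> 0 < y \<Longrightarrow>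
      measure M {1 / (x + y)<..} \<le> measure M {1 / x<..} + measure M {1 / y<..}"
  shows "inverse_subadditive_law (thinned_law p M)"
proof -
  interpret M: nonneg_law M by fact
  interpret T: nonneg_law "thinned_law p M" by (rule nonneg_law_thinned) fact+
  show ?thesis
  proof
    fix x y :: real assume xy: "0 < x" "0 < y"
    have "p * measure M {1 / (x + y)<..} \<le> p * (measure M {1 / x<..} + measure M {1 / y<..})"
      using assms(2,4) xy by (intro mult_left_mono) auto
    then show "measure (thinned_law p M) {1 / (x + y)<..}
        \<le> measure (thinned_law p M) {1 / x<..} + measure (thinned_law p M) {1 / y<..}"
      using xy by (simp add: tail_thinned_law[OF M.real_dist assms(2,3)] distrib_left add_pos_pos)
  qed
qed

lemma st_le_weighted_sample:
  assumes "real_distribution D"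
  shows "st_le (\<Pi>\<^sub>M i\<in>{1..n}. D) (\<lambda>X. \<Sum>i=1..n. \<eta> i * X i) (\<lambda>X. \<Sum>i=1..n. \<theta> i * X i)
    \<longleftrightarrow> st_dominated (weighted_sum_law D (map \<eta> [1..<Suc n])) (weighted_sum_law D (map \<theta> [1..<Suc n]))"
proof -
  interpret D: real_distribution D by fact
  have "measure (\<Pi>\<^sub>M i\<in>{1..n}. D) {X \<in> space (\<Pi>\<^sub>M i\<in>{1..n}. D). x < (\<Sum>i=1..n. \<theta> i * X i)}
      = measure (weighted_sum_law D (map \<theta> [1..<Suc n])) {x<..}" for \<theta> x
    unfolding weighted_sample_law[OF assms, symmetric]
    by (subst measure_distr) (auto intro!: arg_cong2[where f = measure])
  then show ?thesis by (simp add: st_le_def st_dominated_def)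
qed

lemma majorized_iff_lists:
  shows "majorized n \<theta> \<eta> \<longleftrightarrow>
    sum_list (map \<theta> [1..<Suc n]) = sum_list (map \<eta> [1..<Suc n]) \<and>
    (\<forall>j\<le>n. sum_list (take j (sort (map \<eta> [1..<Suc n])))
          \<le> sum_list (take j (sort (map \<theta> [1..<Suc n]))))"
proof -
  have partial: "(\<Sum>i=1..j. incr_rearr n a i) = sum_list (take j (sort (map a [1..<Suc n])))"
    if "j \<le> n" for a j
    using that
  proof (induction j)
    case (Suc j)
    then show ?case
      by (simp add: incr_rearr_def take_Suc_conv_app_nth del: upt_Suc)
  qed simp
  have total: "(\<Sum>i=1..n. incr_rearr n a i) = sum_list (map a [1..<Suc n])" for a
  proof -
    have "(\<Sum>i=1..n. incr_rearr n a i) = sum_list (sort (map a [1..<Suc n]))"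
      by (subst partial) (simp_all del: upt_Suc)
    also have "\<dots> = sum_list (map a [1..<Suc n])"
      by (metis mset_sort sum_mset_sum_list)
    finally show ?thesis .
  qed
  have "(\<forall>j\<le>n. sum_list (take j (sort (map \<eta> [1..<Suc n]))) \<le> sum_list (take j (sort (map \<theta> [1..<Suc n]))))
    \<longleftrightarrow> (\<forall>j\<in>{1..n-1}. (\<Sum>i=1..j. incr_rearr n \<eta> i) \<le> (\<Sum>i=1..j. incr_rearr n \<theta> i))"
    if eq: "sum_list (map \<theta> [1..<Suc n]) = sum_list (map \<eta> [1..<Suc n])"
  proof (intro iffI ballI allI impI)
    fix j assume *: "\<forall>j\<in>{1..n-1}. (\<Sum>i=1..j. incr_rearr n \<eta> i) \<le> (\<Sum>i=1..j. incr_rearr n \<theta> i)"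
      and j: "j \<le> n"
    then consider "j = 0" | "j = n" | "j \<in> {1..n-1}" by fastforce
    then have "(\<Sum>i=1..j. incr_rearr n \<eta> i) \<le> (\<Sum>i=1..j. incr_rearr n \<theta> i)"
      using * eq total by cases auto
    then show "sum_list (take j (sort (map \<eta> [1..<Suc n]))) \<le> sum_list (take j (sort (map \<theta> [1..<Suc n])))"
      unfolding partial[OF j] .
  next
    fix j assume *: "\<forall>j\<le>n. sum_list (take j (sort (map \<eta> [1..<Suc n]))) \<le> sum_list (take j (sort (map \<theta> [1..<Suc n])))"
      and "j \<in> {1..n-1}"
    then have j: "j \<le> n" by auto
    show "(\<Sum>i=1..j. incr_rearr n \<eta> i) \<le> (\<Sum>i=1..j. incr_rearr n \<theta> i)"
      unfolding partial[OF j] using * j by blast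
  qed
  then show ?thesis unfolding majorized_def total by blast
qed

lemma SD_sum_lawI:
  assumes "inverse_concave_law D"
  shows "SD (weighted_sum_law D (replicate m 1))"
  unfolding SD_def
proof (intro allI impI)
  interpret inverse_concave_law D by fact
  fix n :: nat and \<theta> \<eta> :: "nat \<Rightarrow> real"
  assume "2 \<le> n"
    and *: "(\<forall>i\<in>{1..n}. 0 \<le> \<theta> i) \<and> (\<forall>i\<in>{1..n}. 0 \<le> \<eta> i) \<and> majorized n \<theta> \<eta>"
  let ?xs = "map \<theta> [1..<Suc n]" and ?ys = "map \<eta> [1..<Suc n]"
  have perm: "weighted_sum_law D (sort zs) = weighted_sum_law D zs" for zs
    by (rule weighted_sum_law_mset_cong[OF real_dist]) simp
  have "st_dominated (weighted_sum_law D (sort ?ys)) (weighted_sum_law D (sort ?xs))"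
  proof (rule majorization_st_dominated)
    show "sum_list (sort ?xs) = sum_list (sort ?ys)"
      using * unfolding majorized_iff_lists by (metis mset_sort sum_mset_sum_list)
    show "sum_list (take j (sort ?ys)) \<le> sum_list (take j (sort ?xs))" if "j \<le> length (sort ?xs)" for j
      using * that unfolding majorized_iff_lists by (simp del: upt_Suc)
    show "0 \<le> x" if "x \<in> set (sort ?xs) \<union> set (sort ?ys)" for x
      using * that by (auto simp del: upt_Suc)
  qed (simp_all del: upt_Suc)
  then show "st_le (\<Pi>\<^sub>M i\<in>{1..n}. weighted_sum_law D (replicate m 1))
      (\<lambda>X. \<Sum>i=1..n. \<eta> i * X i) (\<lambda>X. \<Sum>i=1..n. \<theta> i * X i)"
    unfolding perm st_le_weighted_sample[OF real_distribution_weighted_sum_law[OF real_dist]]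
      weighted_sum_law_of_sum_law[OF real_dist]
    by (rule weighted_sum_law_concat_mono[OF real_dist])
qed

text \<open>
  A multiple of \<open>X 1\<close> is treated as a weighted sum with weights \<open>s, 0, \<dots>, 0\<close>, which brings both
  sides of the comparison with one variable into the same form.
\<close>

lemma single_weight_sum:
  assumes "1 \<le> (n :: nat)"
  shows "(\<Sum>i=1..n. (if i = 1 then s else 0) * X i) = (s :: real) * X 1"
proof -
  have "(\<Sum>i=1..n. (if i = 1 then s else 0) * X i) = (\<Sum>i=1..n. if i = 1 then s * X i else 0)"
    by (intro sum.cong) auto
  then show ?thesis using assms by (simp add: sum.delta)
qed

lemma single_weight_law:
  assumes "real_distribution D" "1 \<le> (n :: nat)"
  shows "weighted_sum_law D (map (\<lambda>i. if i = 1 then s else 0) [1..<Suc n]) = weighted_sum_law D [s]"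
proof -
  have "[1..<Suc n] = 1 # [2..<Suc n]" using assms(2) by (simp add: upt_conv_Cons numeral_2_eq_2)
  then have "map (\<lambda>i. if i = 1 then s else 0) [1..<Suc n] = [s] @ map (\<lambda>i. 0) [2..<Suc n]"
    by (simp del: upt_Suc)
  then show ?thesis
    using weighted_sum_law_zeros[OF assms(1), of "map (\<lambda>i. 0) [2..<Suc n]" "[s]"] by (simp del: upt_Suc)
qed

lemma SD_star_iff:
  assumes "real_distribution D"
  shows "SD_star D \<longleftrightarrow> (\<forall>n\<ge>2. \<forall>\<theta>. (\<forall>i\<in>{1..n}. 0 \<le> \<theta> i) \<longrightarrow>
    st_dominated (weighted_sum_law D [\<Sum>i=1..n. \<theta> i]) (weighted_sum_law D (map \<theta> [1..<Suc n])))"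
proof -
  have "st_le (\<Pi>\<^sub>M i\<in>{1..n}. D) (\<lambda>X. (\<Sum>i=1..n. \<theta> i) * X 1) (\<lambda>X. \<Sum>i=1..n. \<theta> i * X i)
    \<longleftrightarrow> st_dominated (weighted_sum_law D [\<Sum>i=1..n. \<theta> i]) (weighted_sum_law D (map \<theta> [1..<Suc n]))"
    if "2 \<le> n" for n \<theta>
    using st_le_weighted_sample[OF assms, of n "\<lambda>i. if i = 1 then \<Sum>i=1..n. \<theta> i else 0" \<theta>] that
    unfolding single_weight_law[OF assms, of n, OF order_trans[OF one_le_numeral that]]
    by (subst (asm) single_weight_sum) auto
  then show ?thesis unfolding SD_star_def by auto
qed

lemma SD_star_sum_lawI:
  assumes "inverse_subadditive_law D"
  shows "SD_star (weighted_sum_law D (replicate m 1))"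
proof -
  interpret inverse_subadditive_law D by fact
  show ?thesis
    unfolding SD_star_iff[OF real_distribution_weighted_sum_law[OF real_dist]]
  proof (intro allI impI)
    fix n :: nat and \<theta> :: "nat \<Rightarrow> real"
    assume n: "2 \<le> n" and \<theta>: "\<forall>i\<in>{1..n}. 0 \<le> \<theta> i"
    have "(\<Sum>i=1..n. \<theta> i) = sum_list (map \<theta> [1..<Suc n])"
      by (simp add: sum.distinct_set_conv_list[symmetric] atLeastLessThanSuc_atLeastAtMost del: upt_Suc)
    moreover have "st_dominated (weighted_sum_law D [sum_list (map \<theta> [1..<Suc n])])
        (weighted_sum_law D (map \<theta> [1..<Suc n]))"
      using \<theta> n by (intro subadditive_st_dominated) (auto simp del: upt_Suc)
    ultimately show "st_dominated (weighted_sum_law (weighted_sum_law D (replicate m 1)) [\<Sum>i=1..n. \<theta> i])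
        (weighted_sum_law (weighted_sum_law D (replicate m 1)) (map \<theta> [1..<Suc n]))"
      unfolding weighted_sum_law_of_sum_law[OF real_dist]
      by (simp only: weighted_sum_law_concat_mono[OF real_dist])
  qed
qed

text \<open>
  The weights \<open>(x, y)\<close> are compared with two equal weights at the level \<open>t = 1\<close>.
\<close>

lemma inverse_concave_if_SD:
  assumes M: "nonneg_law M" and m: "0 < m"
    and SD: "\<And>p. 0 < p \<Longrightarrow> p < 1 \<Longrightarrow> SD (weighted_sum_law (thinned_law p M) (replicate m 1))"
  shows "concave_on {0<..} (\<lambda>x. measure M {1 / x<..})"
proof (rule concave_on_midpoint_mono)
  interpret M: nonneg_law M by fact
  show "measure M {1 / x<..} \<le> measure M {1 / y<..}" if "0 < x" "x \<le> y" for x y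
    using that by (intro M.tail_antimono divide_left_mono) auto
  have mid: "measure M {1 / x<..} + measure M {1 / y<..} \<le> 2 * measure M {1 / ((x + y) / 2)<..}"
    if xy: "0 < x" "x \<le> y" for x y
  proof -
    let ?c = "(x + y) / 2"
    let ?\<theta> = "\<lambda>i::nat. ?c" and ?\<eta> = "\<lambda>i::nat. if i = 1 then x else y"
    have lists: "map ?\<theta> [1..<Suc 2] = [?c, ?c]" "map ?\<eta> [1..<Suc 2] = [x, y]"
      by (simp_all add: upt_rec)
    have "majorized 2 ?\<theta> ?\<eta>"
      unfolding majorized_iff_lists lists using xy
      by (auto simp: le_Suc_eq numeral_2_eq_2)
    have "(\<Sum>c\<leftarrow>[x, y]. scaled_tail M 1 c) \<le> (\<Sum>c\<leftarrow>[?c, ?c]. scaled_tail M 1 c)"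
    proof (rule scaled_tail_sum_mono_if_dominated[OF M m])
      fix p :: real assume p: "0 < p" "p < 1"
      note T = real_distribution_thinned_law[OF M.real_dist, of p]
      have "st_le (\<Pi>\<^sub>M i\<in>{1..2}. weighted_sum_law (thinned_law p M) (replicate m 1))
          (\<lambda>X. \<Sum>i=1..2. ?\<eta> i * X i) (\<lambda>X. \<Sum>i=1..2. ?\<theta> i * X i)"
        using \<open>majorized 2 ?\<theta> ?\<eta>\<close> xy
        by (intro SD[OF p, unfolded SD_def, rule_format, of 2 ?\<theta> ?\<eta>]) auto
      then show "st_dominated (weighted_sum_law (thinned_law p M) (concat (replicate m [x, y])))
          (weighted_sum_law (thinned_law p M) (concat (replicate m [?c, ?c])))"
        unfolding st_le_weighted_sample[OF real_distribution_weighted_sum_law[OF T]] lists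
          weighted_sum_law_of_sum_law[OF T] .
    qed (use xy in auto)
    then show ?thesis using xy by (simp add: scaled_tail_pos)
  qed
  show "measure M {1 / x<..} + measure M {1 / y<..} \<le> 2 * measure M {1 / ((x + y) / 2)<..}"
    if "0 < x" "0 < y" for x y
    using mid[of x y] mid[of y x] that by (cases "x \<le> y") (auto simp: add.commute)
qed

lemma inverse_subadditive_if_SD_star:
  assumes M: "nonneg_law M" and m: "0 < m" and xy: "0 < x" "0 < y"
    and SD: "\<And>p. 0 < p \<Longrightarrow> p < 1 \<Longrightarrow> SD_star (weighted_sum_law (thinned_law p M) (replicate m 1))"
  shows "measure M {1 / (x + y)<..} \<le> measure M {1 / x<..} + measure M {1 / y<..}"
proof -
  interpret M: nonneg_law M by fact
  let ?\<theta> = "\<lambda>i::nat. if i = 1 then x else y"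
  have lists: "map ?\<theta> [1..<Suc 2] = [x, y]" "(\<Sum>i=1..2. ?\<theta> i) = x + y"
    by (simp_all add: upt_rec numeral_2_eq_2)
  have "(\<Sum>c\<leftarrow>[x + y]. scaled_tail M 1 c) \<le> (\<Sum>c\<leftarrow>[x, y]. scaled_tail M 1 c)"
  proof (rule scaled_tail_sum_mono_if_dominated[OF M m])
    fix p :: real assume p: "0 < p" "p < 1"
    note T = real_distribution_thinned_law[OF M.real_dist, of p]
    have "st_dominated (weighted_sum_law (weighted_sum_law (thinned_law p M) (replicate m 1)) [\<Sum>i=1..2. ?\<theta> i])
        (weighted_sum_law (weighted_sum_law (thinned_law p M) (replicate m 1)) (map ?\<theta> [1..<Suc 2]))"
      using SD[OF p] xy unfolding SD_star_iff[OF real_distribution_weighted_sum_law[OF T]]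
      by (auto simp del: upt_Suc weighted_sum_law.simps)
    then show "st_dominated (weighted_sum_law (thinned_law p M) (concat (replicate m [x + y])))
        (weighted_sum_law (thinned_law p M) (concat (replicate m [x, y])))"
      unfolding lists weighted_sum_law_of_sum_law[OF T] .
  qed (use xy in auto)
  then show ?thesis using xy by (simp add: scaled_tail_pos)
qed

theorem theorem5p1:
  fixes m :: nat and F :: "real \<Rightarrow> real"
  assumes "m \<ge> 2"
    and "distribution_function F"
    and "non_degenerate F"
    and "(F \<longlongrightarrow> 0) (at_left 0)"
  shows "((\<forall>p\<in>{0<..<1}. SD (compound_binomial m p F)) \<longleftrightarrow> F \<in> class_H) \<and>
         ((\<forall>p\<in>{0<..<1}. SD_star (compound_binomial m p F)) \<longleftrightarrow> F \<in> class_H_star)"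
proof -
  let ?M = "interval_measure F"
  note M = interval_measure_nonneg_law(1)[OF assms(2,4)]
  note tail = interval_measure_nonneg_law(2)[OF assms(2,4)]
  interpret M: nonneg_law ?M by (rule M)
  have adm: "admissible F" using assms by (simp add: admissible_def)
  have m: "0 < m" using assms(1) by simp
  have cb: "compound_binomial m p F = weighted_sum_law (thinned_law p ?M) (replicate m 1)"
    if "p \<in> {0<..<1}" for p
    using that by (intro compound_binomial_eq M.real_dist) auto
  have "(\<forall>p\<in>{0<..<1}. SD (compound_binomial m p F)) \<longleftrightarrow> F \<in> class_H"
  proof
    assume "\<forall>p\<in>{0<..<1}. SD (compound_binomial m p F)"
    then have "concave_on {0<..} (\<lambda>x. measure ?M {1 / x<..})"
      using cb by (intro inverse_concave_if_SD[OF M m]) auto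
    then show "F \<in> class_H" using adm by (simp add: class_H_def tail)
  next
    assume "F \<in> class_H"
    then have "concave_on {0<..} (\<lambda>x. measure ?M {1 / x<..})" by (simp add: class_H_def tail)
    then show "\<forall>p\<in>{0<..<1}. SD (compound_binomial m p F)"
      using cb by (auto intro!: SD_sum_lawI thinned_inverse_concave M)
  qed
  moreover have "(\<forall>p\<in>{0<..<1}. SD_star (compound_binomial m p F)) \<longleftrightarrow> F \<in> class_H_star"
  proof
    assume "\<forall>p\<in>{0<..<1}. SD_star (compound_binomial m p F)"
    then have "measure ?M {1 / (x + y)<..} \<le> measure ?M {1 / x<..} + measure ?M {1 / y<..}"
      if "0 < x" "0 < y" for x y
      using cb that by (intro inverse_subadditive_if_SD_star[OF M m]) auto
    then show "F \<in> class_H_star" using adm by (simp add: class_H_star_def tail)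
  next
    assume "F \<in> class_H_star"
    then have "measure ?M {1 / (x + y)<..} \<le> measure ?M {1 / x<..} + measure ?M {1 / y<..}"
      if "0 < x" "0 < y" for x y
      using that by (simp add: class_H_star_def tail)
    then show "\<forall>p\<in>{0<..<1}. SD_star (compound_binomial m p F)"
      using cb by (auto intro!: SD_star_sum_lawI thinned_inverse_subadditive M)
  qed
  ultimately show ?thesis by blast
qed

end
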